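(* Let $M=(M^{2n+s},f,\xi_i,\eta_i,g)$ be a trans-$S$-manifold. There does not exist a Legendre curve $\gamma:I\to M$ that is $C$-parallel (in the tangent bundle).
   Context: A framed metric $f$-manifold $(M^{2n+s},f,\xi_i,\eta_i,g)$ is a $(2n+s)$-dimensional Riemannian manifold $(M,g)$ with a $(1,1)$-tensor field $f$ of rank $2n$, vector fields $\xi_1,\dots,\xi_s$ and 1-forms $\eta_1,\dots,\eta_s$ such that $f^2=-I+\sum_i\eta_i\otimes\xi_i$, $\eta_i(\xi_j)=\delta_{ij}$, $f\xi_i=0$, $\eta_i\circ f=0$, $g(fX,fY)=g(X,Y)-\sum_i\eta_i(X)\eta_i(Y)$, and $\eta_i(X)=g(X,\xi_i)$. It is normal if $[f,f]+2\sum_i d\eta_i\otimes\xi_i=0$, where $[f,f]$ is the Nijenhuis tensor of $f$ and $2d\eta(X,Y)=X\eta(Y)-Y\eta(X)-\eta([X,Y])$. A trans-$S$-manifold is a normal framed metric $f$-manifold for which there are smooth functions $\alpha_i,\beta_i$ ($i=1,\dots,s$) with $$(\nabla_Xf)Y=\sum_{i=1}^s\Big[\alpha_i\{g(fX,fY)\xi_i+\eta_i(Y)f^2X\}+\beta_i\{g(fX,Y)\xi_i-\eta_i(Y)fX\}\Big]$$ for all vector fields $X,Y$, where $\nabla$ is the Levi-Civita connection of $g$. A unit-speed curve $\gamma$ with $T=\gamma'$ is a Legendre curve if $\eta_i(T)=0$ for all $i=1,\dots,s$. Its mean curvature vector field is $H=\nabla_TT$. A unit-speed curve $\gamma$ is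 $C$-parallel (in the tangent bundle) if $\nabla_TH=\lambda\sum_{i=1}^s\xi_i$ along $\gamma$ for some non-zero (nowhere vanishing) differentiable real-valued function $\lambda$ on $I$. *)

theory Defs
  imports "HOL-Analysis.Analysis"
begin

section \<open>Smooth maps\<close>

text \<open>
  The set \<open>S\<close> is meant to be one on which derivatives within \<open>S\<close> are unique: an open set, or a
  relatively open subset of a nondegenerate real interval (derivatives at end points are then
  one-sided). Second and higher derivatives are taken one direction \<open>v\<close> at a time.
\<close>

primrec Ck_on :: "nat \<Rightarrow> 'b::real_normed_vector set \<Rightarrow> ('b \<Rightarrow> 'c::real_normed_vector) \<Rightarrow> bool" where
  "Ck_on 0 S h \<longleftrightarrow> continuous_on S h"
| "Ck_on (Suc k) S h \<longleftrightarrow>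
     h differentiable_on S \<and> (\<forall>v. Ck_on k S (\<lambda>x. frechet_derivative h (at x within S) v))"

definition smooth_on :: "'b::real_normed_vector set \<Rightarrow> ('b \<Rightarrow> 'c::real_normed_vector) \<Rightarrow> bool" where
  "smooth_on S h \<longleftrightarrow> (\<forall>k. Ck_on k S h)"

section \<open>Charts and tangent vectors\<close>

text \<open>A chart is a pair of its domain and its coordinate map; only the values of the coordinate map
  on the domain matter.\<close>

type_synonym ('a, 'e) chart = "'a set \<times> ('a \<Rightarrow> 'e)"

abbreviation chart_inv :: "('a, 'e) chart \<Rightarrow> 'e \<Rightarrow> 'a" where
  "chart_inv c \<equiv> inv_into (fst c) (snd c)"

abbreviation transition :: "('a, 'e) chart \<Rightarrow> ('a, 'e) chart \<Rightarrow> 'e \<Rightarrow> 'e" where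
  "transition c c' \<equiv> (\<lambda>x. snd c' (chart_inv c x))"

text \<open>A tangent vector at \<open>p\<close> is the family of its component vectors in all charts around \<open>p\<close>,
  related by the Jacobians of the transition maps (see \<open>tangent_space\<close> below). The type of all
  families, compatible or not, is a real vector space under componentwise operations.\<close>

datatype ('a, 'e) tvec = TVec (comp: "('a, 'e) chart \<Rightarrow> 'e")

instantiation tvec :: (type, real_vector) real_vector
begin

definition "0 = TVec (\<lambda>c. 0)"
definition "u + v = TVec (\<lambda>c. comp u c + comp v c)"
definition "u - v = TVec (\<lambda>c. comp u c - comp v c)"
definition "- u = TVec (\<lambda>c. - comp u c)"
definition "r *\<^sub>R u = TVec (\<lambda>c. r *\<^sub>R comp u c)"

instance
  by standard
    (simp_all add: zero_tvec_def plus_tvec_def minus_tvec_def uminus_tvec_def scaleR_tvec_def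
      algebra_simps)

end

section \<open>Smooth manifolds\<close>

text \<open>The atlas need not be maximal.\<close>

locale smooth_manifold =
  fixes M :: "'a topology"
    and A :: "('a, 'e::euclidean_space) chart set"
  assumes hausdorff: "Hausdorff_space M"
    and second_countable: "second_countable M"
    and charts_cover: "(\<Union>c\<in>A. fst c) = topspace M"
    and chart_domain_open: "c \<in> A \<Longrightarrow> openin M (fst c)"
    and chart_image_open: "c \<in> A \<Longrightarrow> open (snd c ` fst c)"
    and chart_homeomorphic:
      "c \<in> A \<Longrightarrow> homeomorphic_map (subtopology M (fst c)) (top_of_set (snd c ` fst c)) (snd c)"
    and transition_smooth:
      "c \<in> A \<Longrightarrow> c' \<in> A \<Longrightarrow> smooth_on (snd c ` (fst c \<inter> fst c')) (transition c c')"
begin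

definition charts_at :: "'a \<Rightarrow> ('a, 'e) chart set" where
  "charts_at p = {c \<in> A. p \<in> fst c}"

definition tangent_space :: "'a \<Rightarrow> ('a, 'e) tvec set" where
  "tangent_space p = {v.
     (\<forall>c\<in>charts_at p. \<forall>c'\<in>charts_at p.
        comp v c' = frechet_derivative (transition c c') (at (snd c p)) (comp v c)) \<and>
     (\<forall>c. c \<notin> charts_at p \<longrightarrow> comp v c = 0)}"

text \<open>The tangent vector at \<open>p\<close> with components \<open>w\<close> in the chart \<open>c\<close>; for a basis vector \<open>w\<close> this is
  the coordinate vector field of \<open>c\<close> in direction \<open>w\<close>.\<close>

definition coord_field :: "('a, 'e) chart \<Rightarrow> 'e \<Rightarrow> 'a \<Rightarrow> ('a, 'e) tvec" where
  "coord_field c w p = TVec (\<lambda>c'.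
     if c' \<in> charts_at p then frechet_derivative (transition c c') (at (snd c p)) w else 0)"

definition smooth_fun_on :: "'a set \<Rightarrow> ('a \<Rightarrow> real) \<Rightarrow> bool" where
  "smooth_fun_on U h \<longleftrightarrow> (\<forall>c\<in>A. smooth_on (snd c ` (U \<inter> fst c)) (\<lambda>x. h (chart_inv c x)))"

definition vector_field_on :: "'a set \<Rightarrow> ('a \<Rightarrow> ('a, 'e) tvec) \<Rightarrow> bool" where
  "vector_field_on U X \<longleftrightarrow> (\<forall>p\<in>U. X p \<in> tangent_space p) \<and>
     (\<forall>c\<in>A. smooth_on (snd c ` (U \<inter> fst c)) (\<lambda>x. comp (X (chart_inv c x)) c))"

abbreviation vector_field :: "('a \<Rightarrow> ('a, 'e) tvec) \<Rightarrow> bool" where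
  "vector_field \<equiv> vector_field_on (topspace M)"

text \<open>The derivative \<open>v h\<close> of the function \<open>h\<close> at \<open>p\<close> in the direction \<open>v\<close>. By the chain rule it
  does not depend on the chart chosen.\<close>

definition dir_deriv :: "'a \<Rightarrow> ('a, 'e) tvec \<Rightarrow> ('a \<Rightarrow> real) \<Rightarrow> real" where
  "dir_deriv p v h = (let c = (SOME c. c \<in> charts_at p) in
     frechet_derivative (\<lambda>x. h (chart_inv c x)) (at (snd c p)) (comp v c))"

text \<open>In coordinates, \<open>[X, Y] = DY(X) - DX(Y)\<close>.\<close>

definition lie_bracket ::
  "('a \<Rightarrow> ('a, 'e) tvec) \<Rightarrow> ('a \<Rightarrow> ('a, 'e) tvec) \<Rightarrow> 'a \<Rightarrow> ('a, 'e) tvec" where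
  "lie_bracket X Y p = TVec (\<lambda>c. if c \<in> charts_at p then
       frechet_derivative (\<lambda>x. comp (Y (chart_inv c x)) c) (at (snd c p)) (comp (X p) c)
     - frechet_derivative (\<lambda>x. comp (X (chart_inv c x)) c) (at (snd c p)) (comp (Y p) c)
     else 0)"

definition linear_at :: "'a \<Rightarrow> (('a, 'e) tvec \<Rightarrow> 'b::real_vector) \<Rightarrow> bool" where
  "linear_at p L \<longleftrightarrow> (\<forall>u\<in>tangent_space p. \<forall>v\<in>tangent_space p. \<forall>a b.
     L (a *\<^sub>R u + b *\<^sub>R v) = a *\<^sub>R L u + b *\<^sub>R L v)"

text \<open>Tensor fields act pointwise on tangent vectors; they are smooth if they map smooth vector
  fields, on any open set, to smooth objects.\<close>

definition one_form :: "('a \<Rightarrow> ('a, 'e) tvec \<Rightarrow> real) \<Rightarrow> bool" where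
  "one_form \<omega> \<longleftrightarrow> (\<forall>p\<in>topspace M. linear_at p (\<omega> p)) \<and>
     (\<forall>U X. openin M U \<longrightarrow> vector_field_on U X \<longrightarrow> smooth_fun_on U (\<lambda>p. \<omega> p (X p)))"

definition tensor_field_1_1 :: "('a \<Rightarrow> ('a, 'e) tvec \<Rightarrow> ('a, 'e) tvec) \<Rightarrow> bool" where
  "tensor_field_1_1 f \<longleftrightarrow> (\<forall>p\<in>topspace M. linear_at p (f p)) \<and>
     (\<forall>p\<in>topspace M. f p ` tangent_space p \<subseteq> tangent_space p) \<and>
     (\<forall>U X. openin M U \<longrightarrow> vector_field_on U X \<longrightarrow> vector_field_on U (\<lambda>p. f p (X p)))"

definition riemannian_metric :: "('a \<Rightarrow> ('a, 'e) tvec \<Rightarrow> ('a, 'e) tvec \<Rightarrow> real) \<Rightarrow> bool" where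
  "riemannian_metric g \<longleftrightarrow>
     (\<forall>p\<in>topspace M. \<forall>u\<in>tangent_space p. linear_at p (g p u)) \<and>
     (\<forall>p\<in>topspace M. \<forall>u\<in>tangent_space p. \<forall>v\<in>tangent_space p. g p u v = g p v u) \<and>
     (\<forall>p\<in>topspace M. \<forall>u\<in>tangent_space p. u \<noteq> 0 \<longrightarrow> g p u u > 0) \<and>
     (\<forall>U X Y. openin M U \<longrightarrow> vector_field_on U X \<longrightarrow> vector_field_on U Y \<longrightarrow>
        smooth_fun_on U (\<lambda>p. g p (X p) (Y p)))"

text \<open>The exterior derivative of a 1-form, with the factor 1/2.\<close>

definition ext_deriv :: "('a \<Rightarrow> ('a, 'e) tvec \<Rightarrow> real) \<Rightarrow>
    ('a \<Rightarrow> ('a, 'e) tvec) \<Rightarrow> ('a \<Rightarrow> ('a, 'e) tvec) \<Rightarrow> 'a \<Rightarrow> real" where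
  "ext_deriv \<omega> X Y p = (dir_deriv p (X p) (\<lambda>q. \<omega> q (Y q)) - dir_deriv p (Y p) (\<lambda>q. \<omega> q (X q))
     - \<omega> p (lie_bracket X Y p)) / 2"

definition nijenhuis :: "('a \<Rightarrow> ('a, 'e) tvec \<Rightarrow> ('a, 'e) tvec) \<Rightarrow>
    ('a \<Rightarrow> ('a, 'e) tvec) \<Rightarrow> ('a \<Rightarrow> ('a, 'e) tvec) \<Rightarrow> 'a \<Rightarrow> ('a, 'e) tvec" where
  "nijenhuis f X Y p = f p (f p (lie_bracket X Y p))
     + lie_bracket (\<lambda>q. f q (X q)) (\<lambda>q. f q (Y q)) p
     - f p (lie_bracket (\<lambda>q. f q (X q)) Y p)
     - f p (lie_bracket X (\<lambda>q. f q (Y q)) p)"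

text \<open>\<open>nabla p v Y\<close> is the covariant derivative at \<open>p\<close> of the vector field \<open>Y\<close>, which need only be
  defined near \<open>p\<close>, in the direction \<open>v\<close>. Since connections are local operators, such an operation
  is the same thing as a connection on globally defined vector fields.\<close>

definition affine_connection ::
    "('a \<Rightarrow> ('a, 'e) tvec \<Rightarrow> ('a \<Rightarrow> ('a, 'e) tvec) \<Rightarrow> ('a, 'e) tvec) \<Rightarrow> bool" where
  "affine_connection nabla \<longleftrightarrow> (\<forall>U. openin M U \<longrightarrow>
     (\<forall>Y. vector_field_on U Y \<longrightarrow> (\<forall>p\<in>U.
        linear_at p (\<lambda>v. nabla p v Y) \<and>
        (\<forall>v\<in>tangent_space p.
           nabla p v Y \<in> tangent_space p \<and>
           (\<forall>Z. (\<forall>q\<in>U. Z q = Y q) \<longrightarrow> nabla p v Z = nabla p v Y) \<and>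
           (\<forall>Z. vector_field_on U Z \<longrightarrow>
              nabla p v (\<lambda>q. Y q + Z q) = nabla p v Y + nabla p v Z) \<and>
           (\<forall>h. smooth_fun_on U h \<longrightarrow>
              nabla p v (\<lambda>q. h q *\<^sub>R Y q) = dir_deriv p v h *\<^sub>R Y p + h p *\<^sub>R nabla p v Y)))) \<and>
     (\<forall>X Y. vector_field_on U X \<longrightarrow> vector_field_on U Y \<longrightarrow>
        vector_field_on U (\<lambda>p. nabla p (X p) Y)))"

definition levi_civita_connection :: "('a \<Rightarrow> ('a, 'e) tvec \<Rightarrow> ('a, 'e) tvec \<Rightarrow> real) \<Rightarrow>
    ('a \<Rightarrow> ('a, 'e) tvec \<Rightarrow> ('a \<Rightarrow> ('a, 'e) tvec) \<Rightarrow> ('a, 'e) tvec) \<Rightarrow> bool" where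
  "levi_civita_connection g nabla \<longleftrightarrow> affine_connection nabla \<and>
     (\<forall>U X Y. openin M U \<longrightarrow> vector_field_on U X \<longrightarrow> vector_field_on U Y \<longrightarrow>
        (\<forall>p\<in>U. nabla p (X p) Y - nabla p (Y p) X = lie_bracket X Y p)) \<and>
     (\<forall>U Y Z. openin M U \<longrightarrow> vector_field_on U Y \<longrightarrow> vector_field_on U Z \<longrightarrow>
        (\<forall>p\<in>U. \<forall>v\<in>tangent_space p.
           dir_deriv p v (\<lambda>q. g q (Y q) (Z q)) = g p (nabla p v Y) (Z p) + g p (Y p) (nabla p v Z)))"

text \<open>Curves are defined on a nondegenerate interval \<open>I\<close>, open or not.\<close>

definition smooth_curve :: "real set \<Rightarrow> (real \<Rightarrow> 'a) \<Rightarrow> bool" where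
  "smooth_curve I \<gamma> \<longleftrightarrow> is_interval I \<and> interior I \<noteq> {} \<and>
     continuous_map (top_of_set I) M \<gamma> \<and>
     (\<forall>c\<in>A. smooth_on {t \<in> I. \<gamma> t \<in> fst c} (\<lambda>t. snd c (\<gamma> t)))"

definition velocity :: "real set \<Rightarrow> (real \<Rightarrow> 'a) \<Rightarrow> real \<Rightarrow> ('a, 'e) tvec" where
  "velocity I \<gamma> t = TVec (\<lambda>c. if c \<in> charts_at (\<gamma> t)
     then vector_derivative (\<lambda>\<tau>. snd c (\<gamma> \<tau>)) (at t within I) else 0)"

text \<open>
  The covariant derivative along \<open>\<gamma>\<close> of a vector field \<open>V\<close> along \<open>\<gamma>\<close>. Writing \<open>V\<close> in a chart as the
  combination of the coordinate fields \<open>\<partial>\<^sub>b\<close> with coefficient functions \<open>V\<^sup>b\<close>, it is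
  the sum over \<open>b\<close> of \<open>(V\<^sup>b)' \<partial>\<^sub>b + V\<^sup>b \<nabla>\<^bsub>\<gamma>'\<^esub> \<partial>\<^sub>b\<close>. The components in each chart are
  computed in that same chart.
\<close>

definition cov_deriv_along ::
    "('a \<Rightarrow> ('a, 'e) tvec \<Rightarrow> ('a \<Rightarrow> ('a, 'e) tvec) \<Rightarrow> ('a, 'e) tvec) \<Rightarrow>
     real set \<Rightarrow> (real \<Rightarrow> 'a) \<Rightarrow> (real \<Rightarrow> ('a, 'e) tvec) \<Rightarrow> real \<Rightarrow> ('a, 'e) tvec" where
  "cov_deriv_along nabla I \<gamma> V t = TVec (\<lambda>c. if c \<in> charts_at (\<gamma> t) then
       vector_derivative (\<lambda>\<tau>. comp (V \<tau>) c) (at t within I)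
       + (\<Sum>b\<in>Basis. (comp (V t) c \<bullet> b) *\<^sub>R
            comp (nabla (\<gamma> t) (velocity I \<gamma> t) (coord_field c b)) c)
     else 0)"

end

section \<open>Riemannian manifolds\<close>

locale riemannian_manifold = smooth_manifold M A
  for M :: "'a topology" and A :: "('a, 'e::euclidean_space) chart set" +
  fixes g :: "'a \<Rightarrow> ('a, 'e) tvec \<Rightarrow> ('a, 'e) tvec \<Rightarrow> real"
    and nabla :: "'a \<Rightarrow> ('a, 'e) tvec \<Rightarrow> ('a \<Rightarrow> ('a, 'e) tvec) \<Rightarrow> ('a, 'e) tvec"
  assumes metric: "riemannian_metric g"
    and levi_civita: "levi_civita_connection g nabla"
begin

definition unit_speed_curve :: "real set \<Rightarrow> (real \<Rightarrow> 'a) \<Rightarrow> bool" where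
  "unit_speed_curve I \<gamma> \<longleftrightarrow> smooth_curve I \<gamma> \<and>
     (\<forall>t\<in>I. g (\<gamma> t) (velocity I \<gamma> t) (velocity I \<gamma> t) = 1)"

definition mean_curvature :: "real set \<Rightarrow> (real \<Rightarrow> 'a) \<Rightarrow> real \<Rightarrow> ('a, 'e) tvec" where
  "mean_curvature I \<gamma> = cov_deriv_along nabla I \<gamma> (velocity I \<gamma>)"

end

section \<open>Framed metric f-manifolds and trans-S-manifolds\<close>

locale framed_metric_f_manifold = riemannian_manifold M A g nabla
  for M :: "'a topology" and A :: "('a, 'e::euclidean_space) chart set" and g nabla +
  fixes n s :: nat
    and f :: "'a \<Rightarrow> ('a, 'e) tvec \<Rightarrow> ('a, 'e) tvec"
    and \<xi> :: "nat \<Rightarrow> 'a \<Rightarrow> ('a, 'e) tvec"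
    and \<eta> :: "nat \<Rightarrow> 'a \<Rightarrow> ('a, 'e) tvec \<Rightarrow> real"
  assumes dimension: "DIM('e) = 2 * n + s"
    and s_pos: "1 \<le> s"
    and f_tensor: "tensor_field_1_1 f"
    and f_rank: "p \<in> topspace M \<Longrightarrow> dim (f p ` tangent_space p) = 2 * n"
    and xi_field: "i \<in> {1..s} \<Longrightarrow> vector_field (\<xi> i)"
    and eta_form: "i \<in> {1..s} \<Longrightarrow> one_form (\<eta> i)"
    and f_square: "p \<in> topspace M \<Longrightarrow> v \<in> tangent_space p \<Longrightarrow>
      f p (f p v) = - v + (\<Sum>i=1..s. \<eta> i p v *\<^sub>R \<xi> i p)"
    and eta_xi: "p \<in> topspace M \<Longrightarrow> i \<in> {1..s} \<Longrightarrow> j \<in> {1..s} \<Longrightarrow>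
      \<eta> i p (\<xi> j p) = (if i = j then 1 else 0)"
    and f_xi: "p \<in> topspace M \<Longrightarrow> i \<in> {1..s} \<Longrightarrow> f p (\<xi> i p) = 0"
    and eta_f: "p \<in> topspace M \<Longrightarrow> i \<in> {1..s} \<Longrightarrow> v \<in> tangent_space p \<Longrightarrow> \<eta> i p (f p v) = 0"
    and metric_f: "p \<in> topspace M \<Longrightarrow> u \<in> tangent_space p \<Longrightarrow> v \<in> tangent_space p \<Longrightarrow>
      g p (f p u) (f p v) = g p u v - (\<Sum>i=1..s. \<eta> i p u * \<eta> i p v)"
    and eta_metric: "p \<in> topspace M \<Longrightarrow> i \<in> {1..s} \<Longrightarrow> v \<in> tangent_space p \<Longrightarrow>
      \<eta> i p v = g p v (\<xi> i p)"
begin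

definition normal :: bool where
  "normal \<longleftrightarrow> (\<forall>X Y. vector_field X \<longrightarrow> vector_field Y \<longrightarrow> (\<forall>p\<in>topspace M.
     nijenhuis f X Y p + 2 *\<^sub>R (\<Sum>i=1..s. ext_deriv (\<eta> i) X Y p *\<^sub>R \<xi> i p) = 0))"

text \<open>\<open>(\<nabla>\<^bsub>X\<^esub> f) Y = \<nabla>\<^bsub>X\<^esub> (f Y) - f (\<nabla>\<^bsub>X\<^esub> Y)\<close>\<close>

definition nabla_f ::
    "('a \<Rightarrow> ('a, 'e) tvec) \<Rightarrow> ('a \<Rightarrow> ('a, 'e) tvec) \<Rightarrow> 'a \<Rightarrow> ('a, 'e) tvec" where
  "nabla_f X Y p = nabla p (X p) (\<lambda>q. f q (Y q)) - f p (nabla p (X p) Y)"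

definition legendre_curve :: "real set \<Rightarrow> (real \<Rightarrow> 'a) \<Rightarrow> bool" where
  "legendre_curve I \<gamma> \<longleftrightarrow> unit_speed_curve I \<gamma> \<and>
     (\<forall>i\<in>{1..s}. \<forall>t\<in>I. \<eta> i (\<gamma> t) (velocity I \<gamma> t) = 0)"

definition C_parallel :: "real set \<Rightarrow> (real \<Rightarrow> 'a) \<Rightarrow> bool" where
  "C_parallel I \<gamma> \<longleftrightarrow> unit_speed_curve I \<gamma> \<and>
     (\<exists>l :: real \<Rightarrow> real. l differentiable_on I \<and> (\<forall>t\<in>I. l t \<noteq> 0) \<and>
        (\<forall>t\<in>I. cov_deriv_along nabla I \<gamma> (mean_curvature I \<gamma>) t
               = l t *\<^sub>R (\<Sum>i=1..s. \<xi> i (\<gamma> t))))"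

end

locale trans_S_manifold = framed_metric_f_manifold M A g nabla n s f \<xi> \<eta>
  for M :: "'a topology" and A :: "('a, 'e::euclidean_space) chart set"
    and g nabla n s f \<xi> \<eta> +
  assumes normal: "normal"
    and trans_S: "\<exists>\<alpha> \<beta> :: nat \<Rightarrow> 'a \<Rightarrow> real.
      (\<forall>i\<in>{1..s}. smooth_fun_on (topspace M) (\<alpha> i) \<and> smooth_fun_on (topspace M) (\<beta> i)) \<and>
      (\<forall>X Y. vector_field X \<longrightarrow> vector_field Y \<longrightarrow> (\<forall>p\<in>topspace M.
         nabla_f X Y p = (\<Sum>i=1..s.
           \<alpha> i p *\<^sub>R (g p (f p (X p)) (f p (Y p)) *\<^sub>R \<xi> i p + \<eta> i p (Y p) *\<^sub>R f p (f p (X p)))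
           + \<beta> i p *\<^sub>R (g p (f p (X p)) (Y p) *\<^sub>R \<xi> i p - \<eta> i p (Y p) *\<^sub>R f p (X p)))))"

end

theory Submission
  imports Defs
begin

text \<open>
  Since the connection is metric, \<open>g(T, T) = 1\<close> gives
  \<open>g(T, H) = 0\<close>, and differentiating once more \<open>g(H, H) + g(T, \<nabla>\<^sub>T H) = 0\<close>. For a C-parallel Legendre
  curve \<open>g(T, \<nabla>\<^sub>T H) = \<lambda> \<Sum>\<^sub>i \<eta>\<^sub>i(T) = 0\<close>, so \<open>H = 0\<close> along the curve, hence \<open>\<lambda> \<Sum>\<^sub>i \<xi>\<^sub>i = \<nabla>\<^sub>T H = 0\<close>, although
  the \<open>\<xi>\<^sub>i\<close> are linearly independent and \<open>\<lambda> \<noteq> 0\<close>.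

  The computation is carried out in a single chart around a point over the interior of the parameter
  interval, so that the transformation law of covariant derivatives is never needed.
\<close>

section \<open>Calculus of smooth maps\<close>

text \<open>The filter \<open>nhds x\<close>, unlike \<open>at x\<close>, sees the point
  \<open>x\<close> itself, so eventual agreement already includes equality of the two values
  there.\<close>

lemma has_derivative_transform_nhds:
  assumes "(f has_derivative D) (at x)" "\<forall>\<^sub>F y in nhds x. f y = g y"
  shows "(g has_derivative D) (at x)"
  using assms has_derivative_transform_eventually[of f D x UNIV g] eventually_nhds_x_imp_x[OF assms(2)]
  by (simp add: eventually_at_filter eventually_mono)

lemma has_vector_derivative_transform_nhds:
  "(f has_vector_derivative D) (at x) \<Longrightarrow> \<forall>\<^sub>F y in nhds x. f y = g y \<Longrightarrow>
    (g has_vector_derivative D) (at x)"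
  unfolding has_vector_derivative_def by (rule has_derivative_transform_nhds)

text \<open>\<open>frechet_derivative\<close> is a choice among all derivatives, so it is enough
  that both functions have the same ones; this covers points without a derivative as well.\<close>

lemma frechet_derivative_within_cong:
  assumes "x \<in> S" "\<And>y. y \<in> S \<Longrightarrow> f y = g y"
  shows "frechet_derivative f (at x within S) = frechet_derivative g (at x within S)"
proof -
  have "(f has_derivative D) (at x within S) \<longleftrightarrow> (g has_derivative D) (at x within S)" for D
    using assms has_derivative_transform[of x S f g D] has_derivative_transform[of x S g f D] by auto
  then show ?thesis
    by (simp add: frechet_derivative_def)
qed

lemma Ck_on_cong:
  assumes "\<And>x. x \<in> S \<Longrightarrow> f x = g x"
  shows "Ck_on k S f \<longleftrightarrow> Ck_on k S g"
  using assms
proof (induction k arbitrary: f g)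
  case 0
  then show ?case
    by (auto intro: continuous_on_cong[THEN iffD1, rotated 2])
next
  case (Suc k)
  have "f differentiable_on S \<longleftrightarrow> g differentiable_on S"
    using Suc.prems has_derivative_transform[of _ S f g] has_derivative_transform[of _ S g f]
    unfolding differentiable_on_def differentiable_def by metis
  moreover have "Ck_on k S (\<lambda>x. frechet_derivative f (at x within S) v) \<longleftrightarrow>
      Ck_on k S (\<lambda>x. frechet_derivative g (at x within S) v)" for v
    using frechet_derivative_within_cong[of _ S f g] Suc.prems
    by (intro Suc.IH) simp
  ultimately show ?case
    by simp
qed

lemma Ck_on_transform:
  "Ck_on k S f \<Longrightarrow> (\<And>x. x \<in> S \<Longrightarrow> f x = g x) \<Longrightarrow> Ck_on k S g"
  using Ck_on_cong[of S f g k] by simp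

lemma Ck_on_SucD: "Ck_on (Suc k) S f \<Longrightarrow> Ck_on k S f"
  by (induction k arbitrary: f) (auto intro: differentiable_imp_continuous_on)

text \<open>At a point of the open set \<open>T\<close> the derivatives within \<open>T\<close> and
  within \<open>S\<close> are both the full derivative. \<open>S\<close> may be an interval with end
  points, which is how curves are restricted to the interior.\<close>

lemma Ck_on_open_subset:
  assumes "Ck_on k S f" "open T" "T \<subseteq> S"
  shows "Ck_on k T f"
  using assms(1)
proof (induction k arbitrary: f)
  case 0
  then show ?case
    using assms(3) continuous_on_subset by auto
next
  case (Suc k)
  have "frechet_derivative f (at x within T) = frechet_derivative f (at x within S)" if "x \<in> T" for x
    using that assms(2,3) by (metis at_within_interior at_within_open interiorI)
  moreover have "Ck_on k T (\<lambda>x. frechet_derivative f (at x within S) v)" for v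
    using Suc by simp
  ultimately have "Ck_on k T (\<lambda>x. frechet_derivative f (at x within T) v)" for v
    by (metis (no_types, lifting) Ck_on_transform)
  then show ?case
    using Suc.prems assms(3) differentiable_on_subset by auto
qed

text \<open>On an open set derivatives are unique, so any explicit derivative \<open>D\<close> may
  stand for \<open>frechet_derivative\<close>. With its converse below, this drives the inductions
  on the order \<open>k\<close>.\<close>

lemma Ck_on_Suc_openI:
  assumes "open S" "\<And>x. x \<in> S \<Longrightarrow> (f has_derivative D x) (at x)"
    and "\<And>v. Ck_on k S (\<lambda>x. D x v)"
  shows "Ck_on (Suc k) S f"
proof -
  have "frechet_derivative f (at x within S) = D x" if "x \<in> S" for x
    using that assms(1,2) by (metis at_within_open frechet_derivative_at)
  then have "Ck_on k S (\<lambda>x. frechet_derivative f (at x within S) v)" for v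
    by (intro Ck_on_transform[OF assms(3)]) simp
  moreover have "f differentiable_on S"
    using assms(2) by (auto simp: differentiable_on_def differentiable_def
        intro: has_derivative_at_withinI)
  ultimately show ?thesis
    by simp
qed

lemma Ck_on_Suc_openD:
  assumes "open S" "Ck_on (Suc k) S f"
  shows "x \<in> S \<Longrightarrow> (f has_derivative frechet_derivative f (at x)) (at x)"
    and "Ck_on k S (\<lambda>x. frechet_derivative f (at x) v)"
proof -
  show "(f has_derivative frechet_derivative f (at x)) (at x)" if "x \<in> S"
    using assms that
    by (metis Ck_on.simps(2) differentiable_on_eq_differentiable_at frechet_derivative_works)
  have "Ck_on k S (\<lambda>x. frechet_derivative f (at x within S) v)"
    using assms(2) by simp
  then show "Ck_on k S (\<lambda>x. frechet_derivative f (at x) v)"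
    by (rule Ck_on_transform) (simp add: at_within_open[OF _ assms(1)])
qed

section \<open>Closure properties of \<open>Ck_on\<close> on open sets\<close>

lemma Ck_on_const:
  assumes "open S"
  shows "Ck_on k S (\<lambda>x. a)"
proof (induction k arbitrary: a)
  case (Suc k)
  show ?case
    by (rule Ck_on_Suc_openI[OF assms has_derivative_const Suc])
qed simp

lemma Ck_on_add:
  assumes "open S" "Ck_on k S f" "Ck_on k S g"
  shows "Ck_on k S (\<lambda>x. f x + g x)"
  using assms(2,3)
proof (induction k arbitrary: f g)
  case 0
  then show ?case
    by (auto intro: continuous_on_add)
next
  case (Suc k)
  note D = Ck_on_Suc_openD[OF assms(1)]
  show ?case
    by (rule Ck_on_Suc_openI[OF assms(1) has_derivative_add
          [OF D(1)[OF Suc.prems(1)] D(1)[OF Suc.prems(2)]]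
          Suc.IH[OF D(2)[OF Suc.prems(1)] D(2)[OF Suc.prems(2)]]])
qed

lemma Ck_on_sum:
  assumes "open S" "finite B" "\<And>b. b \<in> B \<Longrightarrow> Ck_on k S (f b)"
  shows "Ck_on k S (\<lambda>x. \<Sum>b\<in>B. f b x)"
  using assms(2,3) by (induction B rule: finite_induct)
    (auto intro: Ck_on_add Ck_on_const assms(1))

lemma Ck_on_bounded_linear:
  assumes "open S" "bounded_linear L" "Ck_on k S f"
  shows "Ck_on k S (\<lambda>x. L (f x))"
  using assms(3)
proof (induction k arbitrary: f)
  case 0
  then show ?case
    using assms(2) by (auto intro: bounded_linear.continuous_on)
next
  case (Suc k)
  note D = Ck_on_Suc_openD[OF assms(1) Suc.prems]
  show ?case
    by (rule Ck_on_Suc_openI[OF assms(1) bounded_linear.has_derivative[OF assms(2) D(1)]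
          Suc.IH[OF D(2)]])
qed

lemma Ck_on_scaleR:
  assumes "open S" "Ck_on k S f" "Ck_on k S g"
  shows "Ck_on k S (\<lambda>x. f x *\<^sub>R g x)"
  using assms(2,3)
proof (induction k arbitrary: f g)
  case 0
  then show ?case
    by (auto intro: continuous_on_scaleR)
next
  case (Suc k)
  note D = Ck_on_Suc_openD[OF assms(1)]
  \<comment> \<open>Each term of the product rule keeps one factor undifferentiated;
    \<open>Ck_on_SucD\<close> lowers its order to that of the induction hypothesis.\<close>
  show ?case
    by (rule Ck_on_Suc_openI[OF assms(1) has_derivative_scaleR
          [OF D(1)[OF Suc.prems(1)] D(1)[OF Suc.prems(2)]]]; (assumption)?;
        intro Ck_on_add assms(1) Suc.IH Ck_on_SucD[OF Suc.prems(1)] Ck_on_SucD[OF Suc.prems(2)]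
          D(2) Suc.prems)
qed

text \<open>In the chain rule the outer derivative is taken in a direction that varies with
  \<open>x\<close>, whereas \<open>Ck_on\<close> fixes the direction. Expanding that direction in
  \<open>Basis\<close> gives a finite sum of scalar functions times derivatives of \<open>f\<close>
  in fixed directions, to which the induction hypothesis applies.\<close>

lemma Ck_on_compose:
  fixes f :: "'b::euclidean_space \<Rightarrow> 'c::real_normed_vector"
  assumes "open S" "open T" "h ` T \<subseteq> S" "Ck_on k S f" "Ck_on k T h"
  shows "Ck_on k T (\<lambda>x. f (h x))"
  using assms(4,5)
proof (induction k arbitrary: f)
  case 0
  then show ?case
    using assms(3) by (auto intro: continuous_on_compose2)
next
  case (Suc k)
  note Df = Ck_on_Suc_openD[OF assms(1) Suc.prems(1)]
    and Dh = Ck_on_Suc_openD[OF assms(2) Suc.prems(2)]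
  define D where "D x v = (\<Sum>b\<in>Basis. (frechet_derivative h (at x) v \<bullet> b) *\<^sub>R
      frechet_derivative f (at (h x)) b)" for x v
  have "((\<lambda>x. f (h x)) has_derivative D x) (at x)" if "x \<in> T" for x
  proof -
    have hx: "h x \<in> S"
      using that assms(3) by auto
    have L: "linear (frechet_derivative f (at (h x)))"
      using Df(1)[OF hx] has_derivative_linear by blast
    have comb: "frechet_derivative f (at (h x)) w =
        (\<Sum>b\<in>Basis. (w \<bullet> b) *\<^sub>R frechet_derivative f (at (h x)) b)" for w
      using linear_sum[OF L, of "\<lambda>b. (w \<bullet> b) *\<^sub>R b" Basis]
      by (simp add: euclidean_representation linear_scale[OF L])
    have "D x = (\<lambda>v. frechet_derivative f (at (h x)) (frechet_derivative h (at x) v))"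
      unfolding D_def by (rule ext) (rule comb[symmetric])
    then show ?thesis
      using has_derivative_compose[OF Dh(1)[OF that] Df(1)[OF hx]] by simp
  qed
  moreover have "Ck_on k T (\<lambda>x. D x v)" for v
    unfolding D_def
    by (intro Ck_on_sum[OF assms(2) finite_Basis] Ck_on_scaleR[OF assms(2)]
        Ck_on_bounded_linear[OF assms(2) bounded_linear_inner_left Dh(2)]
        Suc.IH[OF Df(2) Ck_on_SucD[OF Suc.prems(2)]])
  ultimately show ?case
    by (rule Ck_on_Suc_openI[OF assms(2)])
qed

lemma smooth_on_has_derivative:
  assumes "open S" "smooth_on S f" "x \<in> S"
  shows "(f has_derivative frechet_derivative f (at x)) (at x)"
  using Ck_on_Suc_openD(1)[OF assms(1)] assms(2,3) unfolding smooth_on_def by blast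

lemma smooth_on_vector_derivative:
  fixes x :: "real \<Rightarrow> 'b::real_normed_vector"
  assumes "open J" "smooth_on J x"
  shows "t \<in> J \<Longrightarrow> (x has_vector_derivative vector_derivative x (at t)) (at t)"
    and "smooth_on J (\<lambda>t. vector_derivative x (at t))"
proof -
  show D: "(x has_vector_derivative vector_derivative x (at t)) (at t)" if "t \<in> J" for t
    using smooth_on_has_derivative[OF assms that] vector_derivative_works differentiableI by blast
  \<comment> \<open>The vector derivative is the Frechet derivative in the direction 1, which is one
    of the functions that \<open>Ck_on\<close> controls.\<close>
  have "vector_derivative x (at t) = frechet_derivative x (at t) 1" if "t \<in> J" for t
    using D[OF that] frechet_derivative_at[of x "\<lambda>h. h *\<^sub>R vector_derivative x (at t)" t]
    unfolding has_vector_derivative_def by (metis scaleR_one)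
  moreover have "Ck_on k J (\<lambda>t. frechet_derivative x (at t) 1)" for k
    using Ck_on_Suc_openD(2)[OF assms(1)] assms(2) unfolding smooth_on_def by blast
  ultimately show "smooth_on J (\<lambda>t. vector_derivative x (at t))"
    unfolding smooth_on_def by (metis (no_types, lifting) Ck_on_transform)
qed

section \<open>Tangent vectors and coordinate fields\<close>

lemma comp_zero [simp]: "comp 0 c = 0"
  and comp_add [simp]: "comp (u + v) c = comp u c + comp v c"
  and comp_scaleR [simp]: "comp (r *\<^sub>R u) c = r *\<^sub>R comp u c"
  by (simp_all add: zero_tvec_def plus_tvec_def scaleR_tvec_def)

lemma comp_sum [simp]: "comp (\<Sum>i\<in>B. u i) c = (\<Sum>i\<in>B. comp (u i) c)"
  by (induction B rule: infinite_finite_induct) auto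

context smooth_manifold
begin

lemma charts_at_iff: "c \<in> charts_at p \<longleftrightarrow> c \<in> A \<and> p \<in> fst c"
  by (auto simp: charts_at_def)

lemma chart_exists: "p \<in> topspace M \<Longrightarrow> \<exists>c. c \<in> charts_at p"
  unfolding charts_cover[symmetric] charts_at_iff by blast

lemma chart_domain_subset: "c \<in> A \<Longrightarrow> fst c \<subseteq> topspace M"
  by (simp add: chart_domain_open openin_subset)

lemma inj_on_chart:
  assumes "c \<in> A"
  shows "inj_on (snd c) (fst c)"
  using homeomorphic_imp_injective_map[OF chart_homeomorphic[OF assms]] chart_domain_subset[OF assms]
  by (simp add: Int_absorb1 inf.absorb2)

lemma chart_inv_chart [simp]: "c \<in> A \<Longrightarrow> p \<in> fst c \<Longrightarrow> chart_inv c (snd c p) = p"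
  by (simp add: inj_on_chart)

lemma open_chart_image:
  assumes "c \<in> A" "openin M U"
  shows "open (snd c ` (U \<inter> fst c))"
proof -
  have "openin (top_of_set (snd c ` fst c)) (snd c ` (U \<inter> fst c))"
    using homeomorphic_map_openness_eq[OF chart_homeomorphic[OF assms(1)]]
      chart_domain_subset[OF assms(1)] assms(2) openin_subtopology_Int
    by (metis (no_types, lifting) inf.absorb_iff2 inf_le2 topspace_subtopology
        homeomorphic_map_openness)
  then show ?thesis
    using chart_image_open[OF assms(1)] openin_open_trans by blast
qed

lemma chart_image_nhds:
  assumes "c \<in> charts_at p" "openin M U" "p \<in> U"
  shows "\<forall>\<^sub>F x in nhds (snd c p). x \<in> snd c ` (U \<inter> fst c)"
  using assms open_chart_image[of c U] by (intro eventually_nhds_in_open) (auto simp: charts_at_iff)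

section \<open>Jacobians of transition maps and the tangent spaces\<close>

abbreviation jacobian :: "('a, 'e) chart \<Rightarrow> ('a, 'e) chart \<Rightarrow> 'a \<Rightarrow> 'e \<Rightarrow> 'e" where
  "jacobian c c' p \<equiv> frechet_derivative (transition c c') (at (snd c p))"

lemma transition_has_derivative:
  assumes "c \<in> charts_at p" "c' \<in> charts_at p"
  shows "(transition c c' has_derivative jacobian c c' p) (at (snd c p))"
proof (rule smooth_on_has_derivative)
  show "open (snd c ` (fst c' \<inter> fst c))"
    using assms by (intro open_chart_image) (auto simp: charts_at_iff chart_domain_open)
  show "smooth_on (snd c ` (fst c' \<inter> fst c)) (transition c c')"
    using transition_smooth[of c c'] assms by (simp add: charts_at_iff Int_commute)
qed (use assms in \<open>auto simp: charts_at_iff\<close>)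

lemma linear_jacobian:
  "c \<in> charts_at p \<Longrightarrow> c' \<in> charts_at p \<Longrightarrow> linear (jacobian c c' p)"
  using transition_has_derivative has_derivative_linear by blast

lemma jacobian_same:
  assumes "c \<in> charts_at p"
  shows "jacobian c c p w = w"
proof -
  have "\<forall>\<^sub>F x in nhds (snd c p). x \<in> snd c ` (fst c \<inter> fst c)"
    using assms by (intro chart_image_nhds) (auto simp: charts_at_iff chart_domain_open)
  then have "\<forall>\<^sub>F x in nhds (snd c p). x = transition c c x"
    by eventually_elim (use assms in \<open>auto simp: charts_at_iff\<close>)
  then have "(transition c c has_derivative (\<lambda>w. w)) (at (snd c p))"
    by (rule has_derivative_transform_nhds[OF has_derivative_ident])
  then show ?thesis
    using frechet_derivative_at by metis
qed

text \<open>This is the cocycle identity: the chain rule, together with the fact that composing the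
  transitions through \<open>c'\<close> gives the transition from \<open>c\<close> to
  \<open>c''\<close> near the image of \<open>p\<close>.\<close>

lemma jacobian_jacobian:
  assumes "c \<in> charts_at p" "c' \<in> charts_at p" "c'' \<in> charts_at p"
  shows "jacobian c' c'' p (jacobian c c' p w) = jacobian c c'' p w"
proof -
  have c'p: "transition c c' (snd c p) = snd c' p"
    using assms by (simp add: charts_at_iff)
  have "((\<lambda>x. transition c' c'' (transition c c' x)) has_derivative
      (\<lambda>w. jacobian c' c'' p (jacobian c c' p w))) (at (snd c p))"
    using has_derivative_compose[OF transition_has_derivative[OF assms(1,2)],
        of "transition c' c''" "jacobian c' c'' p"] transition_has_derivative[OF assms(2,3)] c'p
    by simp
  moreover have "\<forall>\<^sub>F x in nhds (snd c p). transition c' c'' (transition c c' x) = transition c c'' x"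
    using chart_image_nhds[OF assms(1), of "fst c'"] assms
    by (auto simp: charts_at_iff chart_domain_open elim!: eventually_mono)
  ultimately have "(transition c c'' has_derivative
      (\<lambda>w. jacobian c' c'' p (jacobian c c' p w))) (at (snd c p))"
    by (rule has_derivative_transform_nhds)
  then show ?thesis
    using frechet_derivative_at by metis
qed

text \<open>By the cocycle identity, compatibility with a single reference chart implies
  compatibility between any two charts.\<close>

lemma tangent_spaceI_chart:
  assumes "c \<in> charts_at p"
    and "\<And>c'. c' \<in> charts_at p \<Longrightarrow> comp v c' = jacobian c c' p (comp v c)"
    and "\<And>c'. c' \<notin> charts_at p \<Longrightarrow> comp v c' = 0"
  shows "v \<in> tangent_space p"
  unfolding tangent_space_def
proof safe
  fix c' c'' assume "c' \<in> charts_at p" "c'' \<in> charts_at p"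
  then show "comp v c'' = jacobian c' c'' p (comp v c')"
    using assms(2)[of c'] assms(2)[of c''] jacobian_jacobian[OF assms(1)] by metis
qed (rule assms(3))

lemma tangent_spaceD:
  assumes "v \<in> tangent_space p"
  shows "c \<in> charts_at p \<Longrightarrow> c' \<in> charts_at p \<Longrightarrow> comp v c' = jacobian c c' p (comp v c)"
    and "c \<notin> charts_at p \<Longrightarrow> comp v c = 0"
  using assms unfolding tangent_space_def by blast+

lemma comp_coord_field:
  "c' \<in> charts_at p \<Longrightarrow> comp (coord_field c w p) c' = jacobian c c' p w"
  "c' \<notin> charts_at p \<Longrightarrow> comp (coord_field c w p) c' = 0"
  by (simp_all add: coord_field_def)

lemma comp_coord_field_same [simp]:
  "c \<in> charts_at p \<Longrightarrow> comp (coord_field c w p) c = w"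
  by (simp add: comp_coord_field jacobian_same)

lemma coord_field_tangent [simp]:
  "c \<in> charts_at p \<Longrightarrow> coord_field c w p \<in> tangent_space p"
  by (rule tangent_spaceI_chart) (auto simp: comp_coord_field jacobian_same)

text \<open>A tangent vector is determined by its components in one chart; this is what allows all
  later computations to stay in a single chart.\<close>

lemma tangent_eq_coord_field:
  assumes "c \<in> charts_at p" "v \<in> tangent_space p"
  shows "coord_field c (comp v c) p = v"
proof (rule tvec.expand, rule ext)
  fix c'
  show "comp (coord_field c (comp v c) p) c' = comp v c'"
    using tangent_spaceD[OF assms(2)] assms(1)
    by (cases "c' \<in> charts_at p") (metis comp_coord_field)+
qed

lemma tangent_space_subspace: "subspace (tangent_space p)"
proof (rule subspaceI)
  show "0 \<in> tangent_space p"
    unfolding tangent_space_def by (simp add: linear_0[OF linear_jacobian])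
next
  fix u v assume *: "u \<in> tangent_space p" "v \<in> tangent_space p"
  show "u + v \<in> tangent_space p"
    unfolding tangent_space_def
  proof safe
    fix c c' assume c: "c \<in> charts_at p" "c' \<in> charts_at p"
    show "comp (u + v) c' = jacobian c c' p (comp (u + v) c)"
      using tangent_spaceD(1)[OF *(1) c] tangent_spaceD(1)[OF *(2) c]
      by (simp only: comp_add linear_add[OF linear_jacobian[OF c]])
  qed (simp add: tangent_spaceD(2)[OF *(1)] tangent_spaceD(2)[OF *(2)])
next
  fix u r assume *: "u \<in> tangent_space p"
  show "r *\<^sub>R u \<in> tangent_space p"
    unfolding tangent_space_def
  proof safe
    fix c c' assume c: "c \<in> charts_at p" "c' \<in> charts_at p"
    show "comp (r *\<^sub>R u) c' = jacobian c c' p (comp (r *\<^sub>R u) c)"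
      using tangent_spaceD(1)[OF * c]
      by (simp only: comp_scaleR linear_scale[OF linear_jacobian[OF c]])
  qed (simp add: tangent_spaceD(2)[OF *])
qed

text \<open>\<open>linear_at\<close> speaks of tangent vectors only, not of all of
  \<open>tvec\<close>, so tangency of the partial sums has to be carried through the
  induction.\<close>

lemma linear_at_sum:
  assumes "linear_at p L" "finite B" "\<And>b. b \<in> B \<Longrightarrow> u b \<in> tangent_space p"
  shows "L (\<Sum>b\<in>B. r b *\<^sub>R u b) = (\<Sum>b\<in>B. r b *\<^sub>R L (u b))"
  using assms(2,3)
proof (induction B rule: finite_induct)
  case empty
  \<comment> \<open>The combination with zero coefficients yields \<open>L 0 = 0\<close>.\<close>
  have "L (0 *\<^sub>R 0 + 0 *\<^sub>R 0) = 0 *\<^sub>R L 0 + 0 *\<^sub>R L 0"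
    using assms(1) subspace_0[OF tangent_space_subspace] unfolding linear_at_def by blast
  then show ?case
    by simp
next
  case (insert b B)
  have "(\<Sum>b\<in>B. r b *\<^sub>R u b) \<in> tangent_space p"
    using insert.prems
    by (intro subspace_sum subspace_scale tangent_space_subspace) auto
  then have "L (r b *\<^sub>R u b + 1 *\<^sub>R (\<Sum>b\<in>B. r b *\<^sub>R u b)) =
      r b *\<^sub>R L (u b) + 1 *\<^sub>R L (\<Sum>b\<in>B. r b *\<^sub>R u b)"
    using assms(1) insert.prems unfolding linear_at_def by blast
  then show ?case
    using insert by simp
qed

text \<open>The right-hand side is tangent and has the component \<open>w\<close> in
  \<open>c\<close>, and a tangent vector is determined by that component.\<close>

lemma coord_field_Basis:
  assumes "c \<in> charts_at p"
  shows "coord_field c w p = (\<Sum>b\<in>Basis. (w \<bullet> b) *\<^sub>R coord_field c b p)"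
proof -
  have "(\<Sum>b\<in>Basis. (w \<bullet> b) *\<^sub>R coord_field c b p) \<in> tangent_space p"
    using assms by (intro subspace_sum subspace_scale tangent_space_subspace) auto
  from tangent_eq_coord_field[OF assms this] show ?thesis
    using assms by (simp add: euclidean_representation)
qed

lemma linear_at_coord_field:
  assumes "linear_at p L" "c \<in> charts_at p"
  shows "L (coord_field c w p) = (\<Sum>b\<in>Basis. (w \<bullet> b) *\<^sub>R L (coord_field c b p))"
  by (subst coord_field_Basis[OF assms(2)], rule linear_at_sum[OF assms(1)]) (use assms in auto)

lemma coord_field_vector_field:
  assumes "c \<in> A"
  shows "vector_field_on (fst c) (coord_field c w)"
  unfolding vector_field_on_def
proof (intro conjI ballI)
  fix p assume "p \<in> fst c"
  then show "coord_field c w p \<in> tangent_space p"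
    using assms by (simp add: charts_at_iff)
next
  fix c' assume c': "c' \<in> A"
  let ?S = "snd c ` (fst c' \<inter> fst c)" and ?T = "snd c' ` (fst c \<inter> fst c')"
  have "open ?S" "open ?T"
    using assms c' by (auto intro!: open_chart_image chart_domain_open)
  \<comment> \<open>Seen from the chart \<open>c'\<close>, the Jacobian of the transition from
    \<open>c\<close> to \<open>c'\<close> is evaluated at \<open>transition c' c y\<close>, so
    smoothness is that of a composition. One order is spent on the Jacobian.\<close>
  have Ck: "Ck_on k ?T (\<lambda>y. frechet_derivative (transition c c') (at (transition c' c y)) w)" for k
  proof (rule Ck_on_compose[OF \<open>open ?S\<close> \<open>open ?T\<close>, where h = "transition c' c"
        and f = "\<lambda>x. frechet_derivative (transition c c') (at x) w"])
    have "Ck_on (Suc k) ?S (transition c c')"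
      using transition_smooth[OF assms c'] by (simp add: smooth_on_def Int_commute del: Ck_on.simps)
    then show "Ck_on k ?S (\<lambda>x. frechet_derivative (transition c c') (at x) w)"
      by (rule Ck_on_Suc_openD(2)[OF \<open>open ?S\<close>])
    show "Ck_on k ?T (transition c' c)"
      using transition_smooth[OF c' assms] by (simp add: smooth_on_def Int_commute)
  qed (use assms c' in auto)
  have "comp (coord_field c w (chart_inv c' y)) c' =
      frechet_derivative (transition c c') (at (transition c' c y)) w" if "y \<in> ?T" for y
    using that assms c' by (auto simp: coord_field_def charts_at_iff)
  then have "Ck_on k ?T (\<lambda>y. comp (coord_field c w (chart_inv c' y)) c')" for k
    by (intro Ck_on_transform[OF Ck]) simp
  then show "smooth_on ?T (\<lambda>y. comp (coord_field c w (chart_inv c' y)) c')"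
    by (simp add: smooth_on_def)
qed

text \<open>\<open>dir_deriv\<close> computes in a chart picked by \<open>SOME\<close>; the chain
  rule carries the result over to the given chart \<open>c\<close>.\<close>

lemma dir_deriv_eq:
  assumes "openin M U" "p \<in> U" "smooth_fun_on U h" "c \<in> charts_at p"
  shows "((\<lambda>x. h (chart_inv c x)) has_derivative (\<lambda>w. dir_deriv p (coord_field c w p) h))
      (at (snd c p))"
proof -
  define c' where "c' = (SOME c'. c' \<in> charts_at p)"
  have c': "c' \<in> charts_at p"
    unfolding c'_def using assms(4) by (metis someI)
  let ?D = "frechet_derivative (\<lambda>x. h (chart_inv c' x)) (at (snd c' p))"
  have c'p: "transition c c' (snd c p) = snd c' p"
    using assms(4) by (simp add: charts_at_iff)
  have "((\<lambda>x. h (chart_inv c' x)) has_derivative ?D) (at (snd c' p))"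
    using assms c' open_chart_image[OF _ assms(1), of c']
    by (intro smooth_on_has_derivative[of "snd c' ` (U \<inter> fst c')"])
      (auto simp: charts_at_iff smooth_fun_on_def)
  then have "((\<lambda>x. h (chart_inv c' (transition c c' x))) has_derivative
      (\<lambda>w. ?D (jacobian c c' p w))) (at (snd c p))"
    using has_derivative_compose[OF transition_has_derivative[OF assms(4) c'],
        of "\<lambda>x. h (chart_inv c' x)" ?D] c'p by simp
  moreover have "\<forall>\<^sub>F x in nhds (snd c p).
      h (chart_inv c' (transition c c' x)) = h (chart_inv c x)"
    using chart_image_nhds[OF assms(4), of "fst c'"] assms(4) c'
    by (auto simp: charts_at_iff chart_domain_open elim!: eventually_mono)
  ultimately have "((\<lambda>x. h (chart_inv c x)) has_derivative (\<lambda>w. ?D (jacobian c c' p w)))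
      (at (snd c p))"
    by (rule has_derivative_transform_nhds)
  then show ?thesis
    using c' by (simp add: dir_deriv_def Let_def c'_def[symmetric] comp_coord_field)
qed

text \<open>Passing to component vectors turns linearity on a tangent space into
  \<open>linear\<close> on the whole type \<open>'e\<close>, so the standard rules for linear maps
  apply.\<close>

lemma linear_coord_field:
  assumes "linear_at p L" "c \<in> charts_at p"
  shows "linear (\<lambda>w. L (coord_field c w p))"
proof (rule linearI)
  show "L (coord_field c (u + w) p) = L (coord_field c u p) + L (coord_field c w p)" for u w
    by (simp only: linear_at_coord_field[OF assms, of "u + w"] linear_at_coord_field[OF assms, of u]
        linear_at_coord_field[OF assms, of w] inner_add_left scaleR_add_left sum.distrib)
  show "L (coord_field c (r *\<^sub>R u) p) = r *\<^sub>R L (coord_field c u p)" for r u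
    by (simp only: linear_at_coord_field[OF assms, of "r *\<^sub>R u"]
        linear_at_coord_field[OF assms, of u] inner_scaleR_left scaleR_sum_right scaleR_scaleR)
qed

section \<open>Curves\<close>

text \<open>Continuity makes the preimage of the chart domain open relative to \<open>I\<close>;
  cutting down to the interior makes it open in the reals, so all derivatives there are
  two-sided.\<close>

lemma open_curve_chart_domain:
  assumes "smooth_curve I \<gamma>" "c \<in> A"
  shows "open {t \<in> interior I. \<gamma> t \<in> fst c}"
proof -
  have "openin (top_of_set I) {t \<in> I. \<gamma> t \<in> fst c}"
    using assms openin_continuous_map_preimage[of "top_of_set I" M \<gamma> "fst c"]
    by (simp add: smooth_curve_def chart_domain_open)
  then obtain V where "open V" "{t \<in> I. \<gamma> t \<in> fst c} = I \<inter> V"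
    by (auto simp: openin_open)
  then have "{t \<in> interior I. \<gamma> t \<in> fst c} = interior I \<inter> V"
    using interior_subset[of I] by blast
  then show ?thesis
    using \<open>open V\<close> by auto
qed

lemma smooth_on_curve_chart:
  assumes "smooth_curve I \<gamma>" "c \<in> A"
  shows "smooth_on {t \<in> interior I. \<gamma> t \<in> fst c} (\<lambda>t. snd c (\<gamma> t))"
proof -
  have "{t \<in> interior I. \<gamma> t \<in> fst c} \<subseteq> {t \<in> I. \<gamma> t \<in> fst c}"
    using interior_subset[of I] by blast
  then show ?thesis
    using assms Ck_on_open_subset[OF _ open_curve_chart_domain[OF assms]]
    unfolding smooth_curve_def smooth_on_def by blast
qed

lemma comp_velocity:
  assumes "t \<in> interior I" "c \<in> charts_at (\<gamma> t)"
  shows "comp (velocity I \<gamma> t) c = vector_derivative (\<lambda>\<tau>. snd c (\<gamma> \<tau>)) (at t)"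
  using assms(2) by (simp add: velocity_def at_within_interior[OF assms(1)])

lemma curve_chart_has_vector_derivative:
  assumes "smooth_curve I \<gamma>" "t \<in> interior I" "c \<in> charts_at (\<gamma> t)"
  shows "((\<lambda>\<tau>. snd c (\<gamma> \<tau>)) has_vector_derivative comp (velocity I \<gamma> t) c) (at t)"
  using assms smooth_on_vector_derivative(1)
    [OF open_curve_chart_domain[of I \<gamma> c] smooth_on_curve_chart[of I \<gamma> c], of t]
  by (simp add: comp_velocity charts_at_iff)

lemma eventually_curve_chart:
  assumes "smooth_curve I \<gamma>" "t \<in> interior I" "c \<in> charts_at (\<gamma> t)"
  shows "\<forall>\<^sub>F \<tau> in nhds t. \<tau> \<in> interior I \<and> c \<in> charts_at (\<gamma> \<tau>)"
  using assms eventually_nhds_in_open[OF open_curve_chart_domain[of I \<gamma> c], of t]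
  by (simp add: charts_at_iff)

lemma smooth_on_comp_velocity:
  assumes "smooth_curve I \<gamma>" "c \<in> A"
  shows "smooth_on {t \<in> interior I. \<gamma> t \<in> fst c} (\<lambda>t. comp (velocity I \<gamma> t) c)"
proof -
  have "Ck_on k {t \<in> interior I. \<gamma> t \<in> fst c} (\<lambda>t. vector_derivative (\<lambda>\<tau>. snd c (\<gamma> \<tau>)) (at t))" for k
    using smooth_on_vector_derivative(2)[OF open_curve_chart_domain[OF assms]
        smooth_on_curve_chart[OF assms]] by (simp add: smooth_on_def)
  from Ck_on_transform[OF this] show ?thesis
    using assms(2) by (simp add: smooth_on_def comp_velocity charts_at_iff)
qed

text \<open>The chain rule for the transition map gives a second derivative of the same coordinate
  curve, and vector derivatives are unique.\<close>

lemma velocity_tangent: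
  assumes "smooth_curve I \<gamma>" "t \<in> interior I" "c \<in> charts_at (\<gamma> t)"
  shows "velocity I \<gamma> t \<in> tangent_space (\<gamma> t)"
proof (rule tangent_spaceI_chart[OF assms(3)])
  fix c' assume c': "c' \<in> charts_at (\<gamma> t)"
  have "((\<lambda>\<tau>. transition c c' (snd c (\<gamma> \<tau>))) has_vector_derivative
      jacobian c c' (\<gamma> t) (comp (velocity I \<gamma> t) c)) (at t)"
    using has_derivative_compose[OF curve_chart_has_vector_derivative[OF assms,
          unfolded has_vector_derivative_def] transition_has_derivative[OF assms(3) c']]
    by (simp add: has_vector_derivative_def linear_scale[OF linear_jacobian[OF assms(3) c']])
  moreover have "\<forall>\<^sub>F \<tau> in nhds t. transition c c' (snd c (\<gamma> \<tau>)) = snd c' (\<gamma> \<tau>)"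
    using eventually_curve_chart[OF assms]
    by eventually_elim (simp add: charts_at_iff)
  ultimately have "((\<lambda>\<tau>. snd c' (\<gamma> \<tau>)) has_vector_derivative
      jacobian c c' (\<gamma> t) (comp (velocity I \<gamma> t) c)) (at t)"
    by (rule has_vector_derivative_transform_nhds)
  then show "comp (velocity I \<gamma> t) c' = jacobian c c' (\<gamma> t) (comp (velocity I \<gamma> t) c)"
    using curve_chart_has_vector_derivative[OF assms(1,2) c'] vector_derivative_unique_at by blast
qed (simp add: velocity_def)

end

section \<open>The covariant derivative along a curve is metric\<close>

context riemannian_manifold
begin

lemma affine: "affine_connection nabla"
  using levi_civita by (simp add: levi_civita_connection_def)

lemmas metric_smooth =
  metric[unfolded riemannian_metric_def, THEN conjunct2, THEN conjunct2, THEN conjunct2, rule_format]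

lemmas nabla_metric =
  levi_civita[unfolded levi_civita_connection_def, THEN conjunct2, THEN conjunct2, rule_format]

lemma
  assumes "openin M U" "vector_field_on U Y"
  shows linear_at_nabla: "p \<in> U \<Longrightarrow> linear_at p (\<lambda>v. nabla p v Y)"
    and nabla_tangent: "p \<in> U \<Longrightarrow> v \<in> tangent_space p \<Longrightarrow> nabla p v Y \<in> tangent_space p"
    and vector_field_on_nabla:
      "vector_field_on U X \<Longrightarrow> vector_field_on U (\<lambda>p. nabla p (X p) Y)"
proof -
  note U = affine[unfolded affine_connection_def, THEN spec, THEN mp, OF assms(1)]
  note Y = U[THEN conjunct1, THEN spec, THEN mp, OF assms(2)]
  show "p \<in> U \<Longrightarrow> linear_at p (\<lambda>v. nabla p v Y)"
    by (rule Y[THEN bspec, THEN conjunct1])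
  show "p \<in> U \<Longrightarrow> v \<in> tangent_space p \<Longrightarrow> nabla p v Y \<in> tangent_space p"
    by (rule Y[THEN bspec, THEN conjunct2, THEN bspec, THEN conjunct1])
  show "vector_field_on U X \<Longrightarrow> vector_field_on U (\<lambda>p. nabla p (X p) Y)"
    by (rule U[THEN conjunct2, THEN spec, THEN spec, THEN mp, THEN mp, OF _ assms(2)])
qed

lemma metric_linear:
  assumes "p \<in> topspace M" "u \<in> tangent_space p"
  shows "linear_at p (g p u)" "linear_at p (\<lambda>v. g p v u)"
proof -
  show "linear_at p (g p u)"
    using metric assms by (simp add: riemannian_metric_def)
  moreover have "g p v u = g p u v" if "v \<in> tangent_space p" for v
    using metric assms that by (simp add: riemannian_metric_def)
  \<comment> \<open>Symmetry of \<open>g\<close> holds for tangent vectors, so a linear combination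
    must be known to be tangent before its slot can be exchanged.\<close>
  moreover have "a *\<^sub>R v + b *\<^sub>R w \<in> tangent_space p"
    if "v \<in> tangent_space p" "w \<in> tangent_space p" for a b v w
    using that by (intro subspace_add subspace_scale tangent_space_subspace)
  ultimately show "linear_at p (\<lambda>v. g p v u)"
    by (simp add: linear_at_def)
qed

context
  fixes I \<gamma> c t
  assumes curve: "smooth_curve I \<gamma>" and t: "t \<in> interior I" and c: "c \<in> charts_at (\<gamma> t)"
begin

lemma
  shows nabla_coord_field_tangent:
      "v \<in> tangent_space (\<gamma> t) \<Longrightarrow> nabla (\<gamma> t) v (coord_field c b) \<in> tangent_space (\<gamma> t)"
    and linear_at_nabla_coord_field: "linear_at (\<gamma> t) (\<lambda>v. nabla (\<gamma> t) v (coord_field c b))"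
    and vector_field_on_nabla_coord_field:
      "vector_field_on (fst c) (\<lambda>p. nabla p (coord_field c a p) (coord_field c b))"
proof -
  have cA: "c \<in> A" "\<gamma> t \<in> fst c" "openin M (fst c)"
    using c by (auto simp: charts_at_iff chart_domain_open)
  note field = cA(3) coord_field_vector_field[OF cA(1)]
  show "v \<in> tangent_space (\<gamma> t) \<Longrightarrow> nabla (\<gamma> t) v (coord_field c b) \<in> tangent_space (\<gamma> t)"
    by (rule nabla_tangent[OF field cA(2)])
  show "linear_at (\<gamma> t) (\<lambda>v. nabla (\<gamma> t) v (coord_field c b))"
    by (rule linear_at_nabla[OF field cA(2)])
  show "vector_field_on (fst c) (\<lambda>p. nabla p (coord_field c a p) (coord_field c b))"
    by (rule vector_field_on_nabla[OF field coord_field_vector_field[OF cA(1)]])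
qed

text \<open>These are the Christoffel symbols of \<open>c\<close>, smooth in the chart and evaluated
  along the curve. They occur in \<open>H\<close>, which has to be differentiated once more.\<close>

lemma nabla_coord_field_differentiable:
  "(\<lambda>\<tau>. comp (nabla (\<gamma> \<tau>) (coord_field c a (\<gamma> \<tau>)) (coord_field c b)) c) differentiable (at t)"
proof -
  let ?\<Gamma> = "\<lambda>p. comp (nabla p (coord_field c a p) (coord_field c b)) c"
  have "open (snd c ` fst c)" "smooth_on (snd c ` fst c) (\<lambda>x. ?\<Gamma> (chart_inv c x))"
    using vector_field_on_nabla_coord_field[of a b] c chart_image_open[of c]
    by (auto simp: vector_field_on_def charts_at_iff)
  then have "(\<lambda>x. ?\<Gamma> (chart_inv c x)) differentiable (at (snd c (\<gamma> t)))"
    using c smooth_on_has_derivative by (force simp: differentiable_def charts_at_iff)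
  moreover have "(\<lambda>\<tau>. snd c (\<gamma> \<tau>)) differentiable (at t)"
    using curve_chart_has_vector_derivative[OF curve t c] differentiableI_vector by blast
  ultimately have "(\<lambda>\<tau>. ?\<Gamma> (chart_inv c (snd c (\<gamma> \<tau>)))) differentiable (at t)"
    by (rule differentiable_compose)
  then obtain D where D: "((\<lambda>\<tau>. ?\<Gamma> (chart_inv c (snd c (\<gamma> \<tau>)))) has_derivative D) (at t)"
    by (auto simp: differentiable_def)
  have "\<forall>\<^sub>F \<tau> in nhds t. ?\<Gamma> (chart_inv c (snd c (\<gamma> \<tau>))) = ?\<Gamma> (\<gamma> \<tau>)"
    using eventually_curve_chart[OF curve t c] by eventually_elim (simp add: charts_at_iff)
  then have "((\<lambda>\<tau>. ?\<Gamma> (\<gamma> \<tau>)) has_derivative D) (at t)"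
    by (rule has_derivative_transform_nhds[OF D])
  then show ?thesis
    by (auto simp: differentiable_def)
qed

text \<open>Metric compatibility is given for fields on open sets. Coordinate fields are such fields
  on the chart domain, and the chain rule turns the directional derivative along the velocity into a
  derivative in the parameter.\<close>

lemma metric_coord_field_has_derivative:
  "((\<lambda>\<tau>. g (\<gamma> \<tau>) (coord_field c a (\<gamma> \<tau>)) (coord_field c b (\<gamma> \<tau>))) has_real_derivative
     g (\<gamma> t) (nabla (\<gamma> t) (velocity I \<gamma> t) (coord_field c a)) (coord_field c b (\<gamma> t)) +
     g (\<gamma> t) (coord_field c a (\<gamma> t)) (nabla (\<gamma> t) (velocity I \<gamma> t) (coord_field c b))) (at t)"
proof -
  let ?G = "\<lambda>p. g p (coord_field c a p) (coord_field c b p)" and ?T = "velocity I \<gamma> t"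
  have cA: "c \<in> A" "\<gamma> t \<in> fst c" "openin M (fst c)"
    using c by (auto simp: charts_at_iff chart_domain_open)
  have T: "?T \<in> tangent_space (\<gamma> t)"
    by (rule velocity_tangent[OF curve t c])
  note field = coord_field_vector_field[OF cA(1)]
  have "smooth_fun_on (fst c) ?G"
    by (rule metric_smooth[OF cA(3) field field])
  note D = dir_deriv_eq[OF cA(3,2) this c]
  then have "linear (\<lambda>w. dir_deriv (\<gamma> t) (coord_field c w (\<gamma> t)) ?G)"
    using has_derivative_linear by blast
  note lin = linear_scale[OF this]
  have "((\<lambda>\<tau>. ?G (chart_inv c (snd c (\<gamma> \<tau>)))) has_vector_derivative dir_deriv (\<gamma> t) ?T ?G) (at t)"
    using has_derivative_compose[OF curve_chart_has_vector_derivative[OF curve t c,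
          unfolded has_vector_derivative_def] D]
    unfolding has_vector_derivative_def lin tangent_eq_coord_field[OF c T] .
  moreover have "\<forall>\<^sub>F \<tau> in nhds t. ?G (chart_inv c (snd c (\<gamma> \<tau>))) = ?G (\<gamma> \<tau>)"
    using eventually_curve_chart[OF curve t c] by eventually_elim (simp add: charts_at_iff)
  ultimately have "((\<lambda>\<tau>. ?G (\<gamma> \<tau>)) has_vector_derivative dir_deriv (\<gamma> t) ?T ?G) (at t)"
    by (rule has_vector_derivative_transform_nhds)
  moreover have "dir_deriv (\<gamma> t) ?T ?G =
      g (\<gamma> t) (nabla (\<gamma> t) ?T (coord_field c a)) (coord_field c b (\<gamma> t)) +
      g (\<gamma> t) (coord_field c a (\<gamma> t)) (nabla (\<gamma> t) ?T (coord_field c b))"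
    by (rule nabla_metric[OF cA(3) field field cA(2) T])
  ultimately show ?thesis
    by (simp add: has_real_derivative_iff_has_vector_derivative)
qed

text \<open>\<open>cov_comp v' v\<close> is the component vector in \<open>c\<close> of the covariant derivative at \<open>t\<close> of a field
  along \<open>\<gamma>\<close> whose components at \<open>t\<close> are \<open>v\<close> with derivative \<open>v'\<close>.\<close>

definition cov_comp where
  "cov_comp v' v =
     v' + (\<Sum>b\<in>Basis. (v \<bullet> b) *\<^sub>R comp (nabla (\<gamma> t) (velocity I \<gamma> t) (coord_field c b)) c)"

text \<open>The fields exist only along the curve, so metric compatibility cannot be applied to them
  directly. Expanded in coordinate fields, the inner product becomes a sum of products of
  coefficients and Gram matrix entries: differentiating the coefficients gives the terms in
  \<open>v'\<close> and \<open>w'\<close>, differentiating the entries gives the connection terms of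
  \<open>cov_comp\<close>.\<close>

lemma metric_along_curve_has_derivative:
  assumes v: "(v has_vector_derivative v') (at t)" and w: "(w has_vector_derivative w') (at t)"
  shows "((\<lambda>\<tau>. g (\<gamma> \<tau>) (coord_field c (v \<tau>) (\<gamma> \<tau>)) (coord_field c (w \<tau>) (\<gamma> \<tau>))) has_real_derivative
     g (\<gamma> t) (coord_field c (cov_comp v' (v t)) (\<gamma> t)) (coord_field c (w t) (\<gamma> t)) +
     g (\<gamma> t) (coord_field c (v t) (\<gamma> t)) (coord_field c (cov_comp w' (w t)) (\<gamma> t))) (at t)"
proof -
  \<comment> \<open>\<open>B\<close> is the metric as a bilinear form on component vectors;
    \<open>D b\<close> holds the components of the covariant derivative of the coordinate field in
    the direction \<open>b\<close>.\<close>
  define B where "B p u w = g p (coord_field c u p) (coord_field c w p)" for p u w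
  define D where "D b = comp (nabla (\<gamma> t) (velocity I \<gamma> t) (coord_field c b)) c" for b
  have linl: "linear (\<lambda>u. B p u w)" and linr: "linear (\<lambda>w. B p u w)"
    if "c \<in> charts_at p" for p u w
    using that chart_domain_subset[of c] unfolding B_def
    by (auto intro!: linear_coord_field metric_linear simp: charts_at_iff)
  have expand: "B p u w = (\<Sum>a\<in>Basis. \<Sum>b\<in>Basis. (u \<bullet> a) * (w \<bullet> b) * B p a b)"
    if "c \<in> charts_at p" for p u w
  proof -
    have "B p u w = (\<Sum>a\<in>Basis. (u \<bullet> a) * B p a w)" for u w
      using linear_sum[OF linl[OF that], where g = "\<lambda>a. (u \<bullet> a) *\<^sub>R a" and S = Basis]
      by (simp add: euclidean_representation linear_scale[OF linl[OF that]])
    moreover have "B p u w = (\<Sum>b\<in>Basis. (w \<bullet> b) * B p u b)" for u w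
      using linear_sum[OF linr[OF that], where g = "\<lambda>a. (w \<bullet> a) *\<^sub>R a" and S = Basis]
      by (simp add: euclidean_representation linear_scale[OF linr[OF that]])
    ultimately show ?thesis
      by (metis (mono_tags, lifting) mult.assoc sum.cong sum_distrib_left)
  qed
  \<comment> \<open>Since the covariant derivative is tangent, it is recovered from its components
    and may enter a slot of \<open>B\<close>.\<close>
  have D: "coord_field c (D b) (\<gamma> t) = nabla (\<gamma> t) (velocity I \<gamma> t) (coord_field c b)" for b
    unfolding D_def
    by (intro tangent_eq_coord_field c nabla_coord_field_tangent velocity_tangent[OF curve t c])
  have inner: "((\<lambda>\<tau>. u \<tau> \<bullet> b) has_real_derivative u' \<bullet> b) (at t)"
    if "(u has_vector_derivative u') (at t)" for u u' and b :: 'e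
    using bounded_linear.has_vector_derivative[OF bounded_linear_inner_left that]
    by (simp add: has_real_derivative_iff_has_vector_derivative)
  have B: "((\<lambda>\<tau>. B (\<gamma> \<tau>) a b) has_real_derivative B (\<gamma> t) (D a) b + B (\<gamma> t) a (D b)) (at t)" for a b
    using metric_coord_field_has_derivative[of a b] unfolding B_def D .
  have "((\<lambda>\<tau>. \<Sum>a\<in>Basis. \<Sum>b\<in>Basis. (v \<tau> \<bullet> a) * (w \<tau> \<bullet> b) * B (\<gamma> \<tau>) a b) has_real_derivative
     (\<Sum>a\<in>Basis. \<Sum>b\<in>Basis. (v' \<bullet> a) * (w t \<bullet> b) * B (\<gamma> t) a b +
        (v t \<bullet> a) * (w' \<bullet> b) * B (\<gamma> t) a b +
        (v t \<bullet> a) * (w t \<bullet> b) * (B (\<gamma> t) (D a) b + B (\<gamma> t) a (D b)))) (at t)"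
    by (intro DERIV_sum) (rule derivative_eq_intros inner v w B refl | simp add: algebra_simps)+
  moreover have "B (\<gamma> t) (cov_comp v' (v t)) (w t) =
     (\<Sum>a\<in>Basis. \<Sum>b\<in>Basis. (v' \<bullet> a) * (w t \<bullet> b) * B (\<gamma> t) a b) +
     (\<Sum>a\<in>Basis. \<Sum>b\<in>Basis. (v t \<bullet> a) * (w t \<bullet> b) * B (\<gamma> t) (D a) b)"
  proof -
    have "B (\<gamma> t) (D a) (w t) = (\<Sum>b\<in>Basis. (w t \<bullet> b) * B (\<gamma> t) (D a) b)" for a
      using linear_sum[OF linr[OF c], where g = "\<lambda>b. (w t \<bullet> b) *\<^sub>R b" and S = Basis]
      by (simp add: euclidean_representation linear_scale[OF linr[OF c]])
    then show ?thesis
      unfolding cov_comp_def D_def[symmetric] expand[OF c, of v', symmetric]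
      by (simp add: linear_add[OF linl[OF c]] linear_sum[OF linl[OF c]]
          linear_scale[OF linl[OF c]] sum_distrib_left mult.assoc)
  qed
  moreover have "B (\<gamma> t) (v t) (cov_comp w' (w t)) =
     (\<Sum>a\<in>Basis. \<Sum>b\<in>Basis. (v t \<bullet> a) * (w' \<bullet> b) * B (\<gamma> t) a b) +
     (\<Sum>a\<in>Basis. \<Sum>b\<in>Basis. (v t \<bullet> a) * (w t \<bullet> b) * B (\<gamma> t) a (D b))"
  proof -
    have "B (\<gamma> t) (v t) (D b) = (\<Sum>a\<in>Basis. (v t \<bullet> a) * B (\<gamma> t) a (D b))" for b
      using linear_sum[OF linl[OF c], where g = "\<lambda>b. (v t \<bullet> b) *\<^sub>R b" and S = Basis]
      by (simp add: euclidean_representation linear_scale[OF linl[OF c]])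
    \<comment> \<open>Here the connection term of the second slot puts the sum over \<open>b\<close>
      outside, so the sums are swapped to match the expansion.\<close>
    then have "(\<Sum>b\<in>Basis. (w t \<bullet> b) * B (\<gamma> t) (v t) (D b)) =
        (\<Sum>a\<in>Basis. \<Sum>b\<in>Basis. (v t \<bullet> a) * (w t \<bullet> b) * B (\<gamma> t) a (D b))"
      by (subst sum.swap) (simp add: sum_distrib_left mult_ac)
    then show ?thesis
      unfolding cov_comp_def D_def[symmetric] expand[OF c, of _ w', symmetric]
      by (simp add: linear_add[OF linr[OF c]] linear_sum[OF linr[OF c]] linear_scale[OF linr[OF c]])
  qed
  ultimately have "((\<lambda>\<tau>. \<Sum>a\<in>Basis. \<Sum>b\<in>Basis. (v \<tau> \<bullet> a) * (w \<tau> \<bullet> b) * B (\<gamma> \<tau>) a b)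
      has_real_derivative
      B (\<gamma> t) (cov_comp v' (v t)) (w t) + B (\<gamma> t) (v t) (cov_comp w' (w t))) (at t)"
    by (simp add: sum.distrib distrib_left add_ac)
  moreover have "\<forall>\<^sub>F \<tau> in nhds t. (\<Sum>a\<in>Basis. \<Sum>b\<in>Basis. (v \<tau> \<bullet> a) * (w \<tau> \<bullet> b) * B (\<gamma> \<tau>) a b) =
      B (\<gamma> \<tau>) (v \<tau>) (w \<tau>)"
    using eventually_curve_chart[OF curve t c] by eventually_elim (rule expand[symmetric], simp)
  ultimately have "((\<lambda>\<tau>. B (\<gamma> \<tau>) (v \<tau>) (w \<tau>)) has_real_derivative
      B (\<gamma> t) (cov_comp v' (v t)) (w t) + B (\<gamma> t) (v t) (cov_comp w' (w t))) (at t)"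
    unfolding has_real_derivative_iff_has_vector_derivative
    by (rule has_vector_derivative_transform_nhds)
  then show ?thesis
    unfolding B_def .
qed

section \<open>The mean curvature vector in a chart\<close>

lemma comp_cov_deriv_along:
  assumes "((\<lambda>\<tau>. comp (V \<tau>) c) has_vector_derivative v') (at t)"
  shows "comp (cov_deriv_along nabla I \<gamma> V t) c = cov_comp v' (comp (V t) c)"
  using c vector_derivative_at[OF assms]
  by (simp add: cov_deriv_along_def cov_comp_def at_within_interior[OF t])

lemma comp_velocity_has_vector_derivative:
  "((\<lambda>\<tau>. comp (velocity I \<gamma> \<tau>) c) has_vector_derivative
      vector_derivative (\<lambda>\<tau>. comp (velocity I \<gamma> \<tau>) c) (at t)) (at t)"
  using smooth_on_vector_derivative(1)[OF open_curve_chart_domain[OF curve]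
      smooth_on_comp_velocity[OF curve], of c t] c t
  by (simp add: charts_at_iff)

lemma comp_mean_curvature:
  "comp (mean_curvature I \<gamma> t) c =
     cov_comp (vector_derivative (\<lambda>\<tau>. comp (velocity I \<gamma> \<tau>) c) (at t)) (comp (velocity I \<gamma> t) c)"
  unfolding mean_curvature_def
  by (rule comp_cov_deriv_along[OF comp_velocity_has_vector_derivative])

text \<open>Expanding the velocity in the lower slot of \<open>nabla\<close> as well leaves only
  velocity components, their derivatives and Christoffel symbols, all of them differentiable along
  the curve.\<close>

lemma comp_mean_curvature_expand:
  "comp (mean_curvature I \<gamma> t) c =
     vector_derivative (\<lambda>\<tau>. comp (velocity I \<gamma> \<tau>) c) (at t) +
     (\<Sum>b\<in>Basis. (comp (velocity I \<gamma> t) c \<bullet> b) *\<^sub>R (\<Sum>a\<in>Basis. (comp (velocity I \<gamma> t) c \<bullet> a) *\<^sub>R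
        comp (nabla (\<gamma> t) (coord_field c a (\<gamma> t)) (coord_field c b)) c))"
proof -
  have "nabla (\<gamma> t) (velocity I \<gamma> t) (coord_field c b) =
      (\<Sum>a\<in>Basis. (comp (velocity I \<gamma> t) c \<bullet> a) *\<^sub>R
        nabla (\<gamma> t) (coord_field c a (\<gamma> t)) (coord_field c b))" for b
    using linear_at_coord_field[OF linear_at_nabla_coord_field c, of "comp (velocity I \<gamma> t) c"]
    unfolding tangent_eq_coord_field[OF c velocity_tangent[OF curve t c]] .
  then show ?thesis
    unfolding comp_mean_curvature cov_comp_def by simp
qed

end

text \<open>This stands outside the context with fixed \<open>t\<close>, because the expansion is
  used at all parameters near \<open>t\<close>.\<close>

lemma comp_mean_curvature_has_vector_derivative:
  assumes "smooth_curve I \<gamma>" "t \<in> interior I" "c \<in> charts_at (\<gamma> t)"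
  obtains h' where "((\<lambda>\<tau>. comp (mean_curvature I \<gamma> \<tau>) c) has_vector_derivative h') (at t)"
proof -
  let ?J = "{t \<in> interior I. \<gamma> t \<in> fst c}" and ?u = "\<lambda>\<tau>. comp (velocity I \<gamma> \<tau>) c"
  have cA: "c \<in> A" "t \<in> ?J"
    using assms by (auto simp: charts_at_iff)
  note J = open_curve_chart_domain[OF assms(1) cA(1)]
  have u: "?u differentiable (at t)"
    using comp_velocity_has_vector_derivative[OF assms] differentiableI_vector by blast
  have u': "(\<lambda>\<tau>. vector_derivative ?u (at \<tau>)) differentiable (at t)"
    using smooth_on_has_derivative[OF J smooth_on_vector_derivative(2)[OF J
        smooth_on_comp_velocity[OF assms(1) cA(1)]] cA(2)] differentiableI by blast
  have "(\<lambda>\<tau>. ?u \<tau> \<bullet> b) differentiable (at t)" for b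
    using u by (intro differentiable_inner) auto
  then have "(\<lambda>\<tau>. vector_derivative ?u (at \<tau>) + (\<Sum>b\<in>Basis. (?u \<tau> \<bullet> b) *\<^sub>R (\<Sum>a\<in>Basis. (?u \<tau> \<bullet> a) *\<^sub>R
        comp (nabla (\<gamma> \<tau>) (coord_field c a (\<gamma> \<tau>)) (coord_field c b)) c))) differentiable (at t)"
    (is "?h differentiable _")
    by (intro differentiable_add u' differentiable_sum finite_Basis ballI differentiable_scaleR
        nabla_coord_field_differentiable[OF assms])
  then obtain h' where "(?h has_vector_derivative h') (at t)"
    using vector_derivative_works by blast
  moreover have "\<forall>\<^sub>F \<tau> in nhds t. ?h \<tau> = comp (mean_curvature I \<gamma> \<tau>) c"
    using eventually_curve_chart[OF assms]
    by eventually_elim (simp add: comp_mean_curvature_expand[OF assms(1)])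
  ultimately have "((\<lambda>\<tau>. comp (mean_curvature I \<gamma> \<tau>) c) has_vector_derivative h') (at t)"
    by (rule has_vector_derivative_transform_nhds)
  then show ?thesis
    by (rule that)
qed

text \<open>The purely Riemannian half of the argument. Tangency of the derivative of
  \<open>H\<close> is a hypothesis, in place of a transformation law for
  \<open>cov_deriv_along\<close>; for C-parallel curves it comes from the tangency of the \<xi>
  fields.\<close>

lemma nabla_mean_curvature_orthogonal_imp_zero:
  assumes curve: "unit_speed_curve I \<gamma>"
    and tangent: "\<And>t. t \<in> interior I \<Longrightarrow>
      cov_deriv_along nabla I \<gamma> (mean_curvature I \<gamma>) t \<in> tangent_space (\<gamma> t)"
    and orthogonal: "\<And>t. t \<in> interior I \<Longrightarrow>
      g (\<gamma> t) (velocity I \<gamma> t) (cov_deriv_along nabla I \<gamma> (mean_curvature I \<gamma>) t) = 0"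
    and t: "t \<in> interior I"
  shows "cov_deriv_along nabla I \<gamma> (mean_curvature I \<gamma>) t = 0"
proof -
  have sc: "smooth_curve I \<gamma>"
    and unit: "\<And>t. t \<in> interior I \<Longrightarrow> g (\<gamma> t) (velocity I \<gamma> t) (velocity I \<gamma> t) = 1"
    using curve interior_subset[of I] by (auto simp: unit_speed_curve_def)
  have inM: "\<gamma> t \<in> topspace M" if "t \<in> interior I" for t
    using sc that interior_subset[of I] by (auto simp: smooth_curve_def continuous_map_def)
  obtain c where c: "c \<in> charts_at (\<gamma> t)"
    using chart_exists[OF inM[OF t]] by blast
  define u h where "u \<tau> = comp (velocity I \<gamma> \<tau>) c" and "h \<tau> = comp (mean_curvature I \<gamma> \<tau>) c" for \<tau>
  have T: "coord_field c (u \<tau>) (\<gamma> \<tau>) = velocity I \<gamma> \<tau>"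
    if "\<tau> \<in> interior I" "c \<in> charts_at (\<gamma> \<tau>)" for \<tau>
    unfolding u_def by (rule tangent_eq_coord_field[OF that(2) velocity_tangent[OF sc that]])
  have sym: "g p v w = g p w v"
    if "p \<in> topspace M" "v \<in> tangent_space p" "w \<in> tangent_space p" for p v w
    using metric that by (simp add: riemannian_metric_def)
  \<comment> \<open>The tangent vector with components \<open>h \<tau>\<close> in \<open>c\<close>
    stands in for \<open>H\<close>. The claim covers every parameter whose point lies in
    \<open>c\<close>, since it is differentiated again below.\<close>
  have TH: "g (\<gamma> \<tau>) (coord_field c (u \<tau>) (\<gamma> \<tau>)) (coord_field c (h \<tau>) (\<gamma> \<tau>)) = 0"
    if \<tau>: "\<tau> \<in> interior I" "c \<in> charts_at (\<gamma> \<tau>)" for \<tau>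
  proof -
    let ?F = "\<lambda>\<tau>. g (\<gamma> \<tau>) (coord_field c (u \<tau>) (\<gamma> \<tau>)) (coord_field c (u \<tau>) (\<gamma> \<tau>))"
    note u' = comp_velocity_has_vector_derivative[OF sc \<tau>, folded u_def]
    have "(?F has_real_derivative
        g (\<gamma> \<tau>) (coord_field c (h \<tau>) (\<gamma> \<tau>)) (coord_field c (u \<tau>) (\<gamma> \<tau>)) +
        g (\<gamma> \<tau>) (coord_field c (u \<tau>) (\<gamma> \<tau>)) (coord_field c (h \<tau>) (\<gamma> \<tau>))) (at \<tau>)"
      using metric_along_curve_has_derivative[OF sc \<tau> u' u']
      unfolding comp_mean_curvature[OF sc \<tau>, folded h_def u_def, symmetric] .
    moreover have "\<forall>\<^sub>F \<sigma> in nhds \<tau>. 1 = ?F \<sigma>"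
      using eventually_curve_chart[OF sc \<tau>] by eventually_elim (simp add: T unit)
    then have "(?F has_real_derivative 0) (at \<tau>)"
      unfolding has_real_derivative_iff_has_vector_derivative
      by (rule has_vector_derivative_transform_nhds[OF has_vector_derivative_const])
    ultimately show ?thesis
      using DERIV_unique sym[OF inM[OF \<tau>(1)] coord_field_tangent[OF \<tau>(2)]
          coord_field_tangent[OF \<tau>(2)], of "h \<tau>" "u \<tau>"] by fastforce
  qed
  have H0: "h \<tau> = 0" if \<tau>: "\<tau> \<in> interior I" "c \<in> charts_at (\<gamma> \<tau>)" for \<tau>
  proof -
    let ?F = "\<lambda>\<tau>. g (\<gamma> \<tau>) (coord_field c (u \<tau>) (\<gamma> \<tau>)) (coord_field c (h \<tau>) (\<gamma> \<tau>))"
    note u' = comp_velocity_has_vector_derivative[OF sc \<tau>, folded u_def]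
    obtain h' where h': "(h has_vector_derivative h') (at \<tau>)"
      using comp_mean_curvature_has_vector_derivative[OF sc \<tau>] unfolding h_def .
    \<comment> \<open>The hypothesis \<open>tangent\<close> enters here: it identifies the full
      vector with the one rebuilt from its components in \<open>c\<close>.\<close>
    have DH: "coord_field c (cov_comp I \<gamma> c \<tau> h' (h \<tau>)) (\<gamma> \<tau>) =
        cov_deriv_along nabla I \<gamma> (mean_curvature I \<gamma>) \<tau>"
      using comp_cov_deriv_along[OF sc \<tau> h'[unfolded h_def]]
        tangent_eq_coord_field[OF \<tau>(2) tangent[OF \<tau>(1)]] by (simp add: h_def)
    have "(?F has_real_derivative
        g (\<gamma> \<tau>) (coord_field c (h \<tau>) (\<gamma> \<tau>)) (coord_field c (h \<tau>) (\<gamma> \<tau>)) +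
        g (\<gamma> \<tau>) (velocity I \<gamma> \<tau>) (cov_deriv_along nabla I \<gamma> (mean_curvature I \<gamma>) \<tau>)) (at \<tau>)"
      using metric_along_curve_has_derivative[OF sc \<tau> u' h']
      unfolding comp_mean_curvature[OF sc \<tau>, folded h_def u_def, symmetric] DH T[OF \<tau>] .
    moreover have "\<forall>\<^sub>F \<sigma> in nhds \<tau>. 0 = ?F \<sigma>"
      using eventually_curve_chart[OF sc \<tau>] by eventually_elim (simp add: TH)
    then have "(?F has_real_derivative 0) (at \<tau>)"
      unfolding has_real_derivative_iff_has_vector_derivative
      by (rule has_vector_derivative_transform_nhds[OF has_vector_derivative_const])
    ultimately have "g (\<gamma> \<tau>) (coord_field c (h \<tau>) (\<gamma> \<tau>)) (coord_field c (h \<tau>) (\<gamma> \<tau>)) = 0"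
      using DERIV_unique orthogonal[OF \<tau>(1)] by fastforce
    then have "coord_field c (h \<tau>) (\<gamma> \<tau>) = 0"
      using metric inM[OF \<tau>(1)] coord_field_tangent[OF \<tau>(2)] less_irrefl
      unfolding riemannian_metric_def by metis
    then show ?thesis
      using comp_coord_field_same[OF \<tau>(2), of "h \<tau>"] by simp
  qed
  \<comment> \<open>\<open>h\<close> vanishes near \<open>t\<close>, not only at \<open>t\<close>,
    so both arguments of \<open>cov_comp\<close> are zero.\<close>
  have "\<forall>\<^sub>F \<tau> in nhds t. 0 = h \<tau>"
    using eventually_curve_chart[OF sc t c] by eventually_elim (simp add: H0)
  then have "(h has_vector_derivative 0) (at t)"
    by (rule has_vector_derivative_transform_nhds[OF has_vector_derivative_const])
  then have "comp (cov_deriv_along nabla I \<gamma> (mean_curvature I \<gamma>) t) c = 0"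
    using comp_cov_deriv_along[OF sc t c, of "mean_curvature I \<gamma>" 0, folded h_def] H0[OF t c]
    by (simp add: cov_comp_def[OF sc t c])
  moreover have "(0 :: ('a, 'e) tvec) \<in> tangent_space (\<gamma> t)"
    by (rule subspace_0[OF tangent_space_subspace])
  ultimately show ?thesis
    \<comment> \<open>Two tangent vectors with the same components in \<open>c\<close> coincide; the
      second one is the zero vector.\<close>
    using tangent_eq_coord_field[OF c tangent[OF t]] tangent_eq_coord_field[OF c, of 0] by simp
qed

end

section \<open>Legendre curves and the structure vector fields\<close>

context framed_metric_f_manifold
begin

lemma no_C_parallel_legendre_curve:
  assumes legendre: "legendre_curve I \<gamma>" and parallel: "C_parallel I \<gamma>"
  shows False
proof -
  let ?DH = "cov_deriv_along nabla I \<gamma> (mean_curvature I \<gamma>)"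
  have unit: "unit_speed_curve I \<gamma>"
    using legendre by (simp add: legendre_curve_def)
  then have sc: "smooth_curve I \<gamma>"
    by (simp add: unit_speed_curve_def)
  obtain l where l: "\<And>t. t \<in> interior I \<Longrightarrow> l t \<noteq> (0::real)"
    and DH: "\<And>t. t \<in> interior I \<Longrightarrow> ?DH t = l t *\<^sub>R (\<Sum>i=1..s. \<xi> i (\<gamma> t))"
    using parallel interior_subset[of I] unfolding C_parallel_def by blast
  have inM: "\<gamma> t \<in> topspace M" if "t \<in> interior I" for t
    using sc that interior_subset[of I] by (auto simp: smooth_curve_def continuous_map_def)
  have xi: "\<xi> i (\<gamma> t) \<in> tangent_space (\<gamma> t)" if "t \<in> interior I" "i \<in> {1..s}" for t i
    using xi_field[OF that(2)] inM[OF that(1)] by (simp add: vector_field_on_def)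
  have DH_sum: "?DH t = (\<Sum>i=1..s. l t *\<^sub>R \<xi> i (\<gamma> t))" if "t \<in> interior I" for t
    using DH[OF that] by (simp add: scaleR_sum_right)
  \<comment> \<open>A parameter to work at exists because \<open>smooth_curve\<close> demands an
    interval with nonempty interior.\<close>
  obtain t where t: "t \<in> interior I"
    using sc by (auto simp: smooth_curve_def)
  have "?DH t = 0"
  proof (rule nabla_mean_curvature_orthogonal_imp_zero[OF unit _ _ t])
    fix \<tau> assume \<tau>: "\<tau> \<in> interior I"
    show "?DH \<tau> \<in> tangent_space (\<gamma> \<tau>)"
      unfolding DH_sum[OF \<tau>] using xi[OF \<tau>]
      by (intro subspace_sum subspace_scale tangent_space_subspace)
    obtain c where "c \<in> charts_at (\<gamma> \<tau>)"
      using chart_exists[OF inM[OF \<tau>]] by blast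
    note T = velocity_tangent[OF sc \<tau> this]
    \<comment> \<open>The Legendre condition becomes orthogonality to each \<xi> field, as \<eta> is
      the metric dual of \<xi>.\<close>
    have "g (\<gamma> \<tau>) (velocity I \<gamma> \<tau>) (\<xi> i (\<gamma> \<tau>)) = 0" if "i \<in> {1..s}" for i
      using eta_metric[OF inM[OF \<tau>] that T] legendre that \<tau> interior_subset[of I]
      by (auto simp: legendre_curve_def)
    then show "g (\<gamma> \<tau>) (velocity I \<gamma> \<tau>) (?DH \<tau>) = 0"
      unfolding DH_sum[OF \<tau>]
      using linear_at_sum[OF metric_linear(1)[OF inM[OF \<tau>] T], of "{1..s}" "\<lambda>i. \<xi> i (\<gamma> \<tau>)"] xi[OF \<tau>]
      by simp
  qed
  \<comment> \<open>The form \<open>\<eta> 1\<close>, available because \<open>1 \<le> s\<close>,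
    reads off the coefficient \<open>l t\<close> from the sum of the \<xi> fields and so detects
    that the sum is nonzero.\<close>
  have eta: "linear_at (\<gamma> t) (\<eta> 1 (\<gamma> t))"
    using eta_form[of 1] s_pos inM[OF t] by (simp add: one_form_def)
  have "\<eta> 1 (\<gamma> t) (?DH t) = (\<Sum>i=1..s. l t *\<^sub>R \<eta> 1 (\<gamma> t) (\<xi> i (\<gamma> t)))"
    unfolding DH_sum[OF t] by (rule linear_at_sum[OF eta]) (use xi[OF t] in auto)
  also have "\<dots> = (\<Sum>i=1..s. if i = 1 then l t else 0)"
    using s_pos eta_xi[OF inM[OF t], of 1] by (intro sum.cong) auto
  also have "\<dots> = l t"
    using s_pos by simp
  finally have "\<eta> 1 (\<gamma> t) 0 = l t"
    using \<open>?DH t = 0\<close> by simp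
  \<comment> \<open>The empty sum in \<open>linear_at_sum\<close> gives the value at the zero
    vector.\<close>
  moreover have "\<eta> 1 (\<gamma> t) 0 = 0"
    using linear_at_sum[OF eta, of "{}"] by simp
  ultimately show False
    using l[OF t] by simp
qed

end

theorem theorem2:
  fixes M :: "'a topology"
    and A :: "('a, 'e::euclidean_space) chart set"
    and g :: "'a \<Rightarrow> ('a, 'e) tvec \<Rightarrow> ('a, 'e) tvec \<Rightarrow> real"
    and nabla :: "'a \<Rightarrow> ('a, 'e) tvec \<Rightarrow> ('a \<Rightarrow> ('a, 'e) tvec) \<Rightarrow> ('a, 'e) tvec"
    and n s :: nat
    and f :: "'a \<Rightarrow> ('a, 'e) tvec \<Rightarrow> ('a, 'e) tvec"
    and \<xi> :: "nat \<Rightarrow> 'a \<Rightarrow> ('a, 'e) tvec"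
    and \<eta> :: "nat \<Rightarrow> 'a \<Rightarrow> ('a, 'e) tvec \<Rightarrow> real"
  assumes "trans_S_manifold M A g nabla n s f \<xi> \<eta>"
  shows "\<not> (\<exists>I \<gamma>. framed_metric_f_manifold.legendre_curve M A g s \<eta> I \<gamma>
                 \<and> framed_metric_f_manifold.C_parallel M A g nabla s \<xi> I \<gamma>)"
proof -
  interpret trans_S_manifold M A g nabla n s f \<xi> \<eta>
    by (rule assms)
  show ?thesis
    using no_C_parallel_legendre_curve by blast
qed

end
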